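(* Let $n\ge3$, let $P_\sigma^t$ be the distribution of the discrete time sandpile chain on the complete graph $K_n$ after $t$ steps started at a fixed recurrent state $\sigma$, and let $U$ be the uniform distribution on recurrent states. For any $c\ge 5/4$, $$\|P_\sigma^t-U\|_{\mathrm{TV}}\le e^{-c}\quad\text{for all } t\ge\frac{1}{4\pi^2}n^3\log n+cn^3,$$ $$\|P_\sigma^t-U\|_{\mathrm{TV}}\ge 1-e^{-35c}\quad\text{for all } 0\le t\le\frac{1}{4\pi^2}n^3\log n-cn^3.$$
   Context: Sandpile chain on a finite simple connected graph $G=(V,E)$ with $n$ vertices and designated sink $s$: a configuration is $\eta:V\setminus\{s\}\to\mathbb{N}$. It is stable if $\eta(v)<\deg(v)$ for all $v\ne s$. A vertex $v\neq s$ with $\eta(v)\ge\deg(v)$ may topple, losing $\deg(v)$ chips and giving one to each neighbor (chips sent to $s$ vanish). Toppling unstable vertices until none remain gives a stable configuration $\eta^\circ$ independent of the order. Put $\eta\oplus\sigma=(\eta+\sigma)^\circ$ on stable configurations. With $\eta_*(v)=\deg(v)-1$, the set $\mathcal{G}$ of recurrent states consists of all stable configurations of the form $\eta_*\oplus\sigma$ with $\sigma$ stable; it is a finite abelian group under $\oplus$. The discrete time sandpile chain on $\mathcal{G}$ moves from $\eta$ to $(\eta+\delta_v)^\circ$ with $v$ uniform in $V$ (all $n$ vertices), where $\delta_v(u)=1\{u=v\}$ and $\delta_s\equiv0$. Time $t$ ranges over $\mathbb{N}$. $\|\mu-\nu\|_{\mathrm{TV}}=\frac12\sum_{g\in\mathcal{G}}|\mu(g)-\nu(g)|$;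 $\log$ is the natural logarithm. *)

theory Defs
  imports "HOL-Probability.Probability" "Graph_Theory.Graph_Theory"
begin

text \<open>
  Finite simple graphs are the symmetric, loop-free digraphs without parallel arcs of the locale
  \<^locale>\<open>graph\<close>; there \<^term>\<open>out_degree G v\<close> is the number of neighbours of \<open>v\<close>.
  The name \<open>connected\<close> has to be qualified, since it also denotes topological connectedness.
\<close>

locale sandpile = graph G for G :: "('a, 'b) pre_digraph" (structure) +
  fixes s :: 'a
  assumes sink_in_verts: "s \<in> verts G"
    and connected_graph: "Digraph_Component.connected G"
begin

abbreviation deg :: "'a \<Rightarrow> nat" where
  "deg v \<equiv> out_degree G v"

text \<open>
  A map from \<open>V - {s}\<close> to the naturals is represented by its extension by zero to the whole
  type, so that equality of configurations is equality of functions.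
\<close>

definition config :: "('a \<Rightarrow> nat) \<Rightarrow> bool" where
  "config \<eta> \<longleftrightarrow> (\<forall>v. v \<notin> verts G - {s} \<longrightarrow> \<eta> v = 0)"

definition stable :: "('a \<Rightarrow> nat) \<Rightarrow> bool" where
  "stable \<eta> \<longleftrightarrow> config \<eta> \<and> (\<forall>v \<in> verts G - {s}. \<eta> v < deg v)"

text \<open>The subtraction is only used at vertices that may topple, where it does not truncate.\<close>

definition topple :: "'a \<Rightarrow> ('a \<Rightarrow> nat) \<Rightarrow> ('a \<Rightarrow> nat)" where
  "topple v \<eta> = (\<lambda>u. if u = v then \<eta> u - deg v
                     else if u \<noteq> s \<and> v \<rightarrow> u then \<eta> u + 1
                     else \<eta> u)"

definition topples :: "('a \<Rightarrow> nat) \<Rightarrow> ('a \<Rightarrow> nat) \<Rightarrow> bool" where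
  "topples \<eta> \<xi> \<longleftrightarrow> (\<exists>v \<in> verts G - {s}. deg v \<le> \<eta> v \<and> \<xi> = topple v \<eta>)"

text \<open>
  On configurations, existence and uniqueness of \<open>\<xi>\<close> are the classical facts that toppling
  terminates and that its outcome does not depend on the order.
\<close>

definition stabilization :: "('a \<Rightarrow> nat) \<Rightarrow> ('a \<Rightarrow> nat)" where
  "stabilization \<eta> = (THE \<xi>. topples\<^sup>*\<^sup>* \<eta> \<xi> \<and> stable \<xi>)"

definition sandpile_add :: "('a \<Rightarrow> nat) \<Rightarrow> ('a \<Rightarrow> nat) \<Rightarrow> ('a \<Rightarrow> nat)" where
  "sandpile_add \<eta> \<sigma> = stabilization (\<lambda>v. \<eta> v + \<sigma> v)"

definition max_stable :: "'a \<Rightarrow> nat" where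
  "max_stable = (\<lambda>v. if v \<in> verts G - {s} then deg v - 1 else 0)"

definition recurrent :: "('a \<Rightarrow> nat) set" where
  "recurrent = {\<eta>. stable \<eta> \<and> (\<exists>\<sigma>. stable \<sigma> \<and> \<eta> = sandpile_add max_stable \<sigma>)}"

definition chip :: "'a \<Rightarrow> ('a \<Rightarrow> nat)" where
  "chip v = (\<lambda>u. if v \<noteq> s \<and> u = v then 1 else 0)"

definition chain_step :: "('a \<Rightarrow> nat) \<Rightarrow> ('a \<Rightarrow> nat) pmf" where
  "chain_step \<eta> = map_pmf (\<lambda>v. stabilization (\<lambda>u. \<eta> u + chip v u)) (pmf_of_set (verts G))"

primrec chain_dist :: "('a \<Rightarrow> nat) \<Rightarrow> nat \<Rightarrow> ('a \<Rightarrow> nat) pmf" where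
  "chain_dist \<sigma> 0 = return_pmf \<sigma>"
| "chain_dist \<sigma> (Suc t) = bind_pmf (chain_dist \<sigma> t) chain_step"

definition uniform_dist :: "('a \<Rightarrow> nat) pmf" where
  "uniform_dist = pmf_of_set recurrent"

definition tv_dist :: "('a \<Rightarrow> nat) pmf \<Rightarrow> ('a \<Rightarrow> nat) pmf \<Rightarrow> real" where
  "tv_dist P Q = 1 / 2 * (\<Sum>g \<in> recurrent. \<bar>pmf P g - pmf Q g\<bar>)"

text \<open>There are only finitely many stable configurations, so the sum in \<open>tv_dist\<close> is a finite one.\<close>

lemma finite_recurrent: "finite recurrent"
proof -
  let ?F = "{\<eta>. \<eta> \<in> verts G \<rightarrow> {..Max (deg ` verts G)} \<and> (\<forall>v. v \<notin> verts G \<longrightarrow> \<eta> v = 0)}"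
  have "\<eta> \<in> ?F" if "stable \<eta>" for \<eta>
  proof -
    have "\<eta> v \<le> Max (deg ` verts G)" if v: "v \<in> verts G" for v
    proof -
      have "\<eta> v \<le> deg v"
        using \<open>stable \<eta>\<close> v by (cases "v = s") (auto simp: stable_def config_def intro: less_imp_le)
      also have "\<dots> \<le> Max (deg ` verts G)" using v by (intro Max_ge) auto
      finally show ?thesis .
    qed
    with that show ?thesis by (auto simp: stable_def config_def)
  qed
  then have "recurrent \<subseteq> ?F" by (auto simp: recurrent_def)
  moreover have "finite ?F"
    using finite_set_of_finite_funs[of "verts G" "{..Max (deg ` verts G)}" "0::nat"]
    by (rule rev_finite_subset) auto
  ultimately show ?thesis by (rule finite_subset)
qed

end

lemma complete_digraph_sandpile:
  assumes "K\<^bsub>n\<^esub> G" and "s \<in> verts G"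
  shows "sandpile G s"
proof -
  from assms interpret graph G by (simp add: complete_digraph_def)
  have adj: "arcs_ends G = {(u, v). (u, v) \<in> verts G \<times> verts G \<and> u \<noteq> v}"
    using assms by (simp add: complete_digraph_def)
  have "(u, v) \<in> rtrancl_on (verts G) ((arcs_ends G)\<^sup>s)"
    if "u \<in> verts G" "v \<in> verts G" for u v
    using that adj by (cases "u = v") (auto simp: symcl_def intro: rtrancl_on_into_rtrancl_on)
  with assms have "Digraph_Component.connected G" by (auto simp: connected_conv)
  with assms show ?thesis by unfold_locales auto
qed

end

theory Submission
  imports Defs "HOL-Library.Real_Mod"
begin

text \<open>
  On \<open>K\<^sub>n\<close> a toppling adds 1 to every coordinate modulo \<open>n\<close>, so a recurrent state is determined by the
  differences of its coordinates modulo \<open>n\<close>. The characters are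
  \<open>\<eta> \<mapsto> exp (2\<pi>i (\<Sum>v. j v * \<eta> v) / n)\<close> with \<open>j s = 0\<close> and \<open>\<Sum>v. j v\<close> divisible by \<open>n\<close>; they are
  eigenfunctions of the chain whose eigenvalue is the average of the \<open>n\<close>-th roots of unity
  \<open>\<omega>\<^sup>j\<^sup>(\<^sup>v\<^sup>)\<close>, of squared modulus \<open>1 - (\<Sum>u v. 1 - cos (2\<pi>(j u - j v)/n)) / n\<^sup>2\<close>.

  Upper bound: by Cauchy--Schwarz and Parseval, \<open>4 TV\<^sup>2\<close> is at most the sum of \<open>|\<lambda>\<^sub>j|\<^sup>2\<^sup>t\<close> over the
  nontrivial characters. If no value of \<open>j\<close> is taken by more than \<open>n/6\<close> vertices, then
  \<open>|\<lambda>\<^sub>j|\<^sup>2\<^sup>t\<close> is small compared with \<open>n\<^sup>-\<^sup>n\<close>, which beats the number of characters. Otherwise only the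
  pairs with exactly one vertex at the mode of \<open>j\<close> are kept in the double sum, and the bound
  becomes a product over the \<open>k\<close> vertices off the mode, so that the sum over \<open>j\<close> factorizes.

  Lower bound: the statistic is \<open>|\<Sum>v. \<omega>\<^sup>d\<^sup>(\<^sup>v\<^sup>)|\<^sup>2 - (n - 1)\<close> with \<open>d\<close> the displacement from the initial
  state, a sum of \<open>(n - 1)(n - 2)\<close> characters with eigenvalue \<open>1 - 2(1 - cos (2\<pi>/n))/n\<close>. Markov's inequality
  under the uniform distribution and Chebyshev's inequality under the law of the chain separate
  the two. The range of \<open>t\<close> is nonempty only if \<open>ln n \<ge> 4\<pi>\<^sup>2c > 49\<close>, so \<open>n\<close> is huge there.
\<close>

section \<open>Sandpiles on complete graphs\<close>

lemma (in graph) out_degree_eq_card_dominated: "out_degree G v = card {u. v \<rightarrow> u}"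
proof -
  have "{u. v \<rightarrow> u} = head G ` out_arcs G v"
    by (force simp: out_arcs_def arcs_ends_def arc_to_ends_def)
  moreover have "inj_on (head G) (out_arcs G v)"
    by (rule inj_onI) (auto intro!: no_multi_arcs simp: arc_to_ends_def)
  ultimately show ?thesis
    by (simp add: out_degree_def card_image)
qed

locale complete_sandpile = sandpile G s for G :: "('a, 'b) pre_digraph" (structure) and s +
  fixes n :: nat
  assumes complete: "complete_digraph n G"
    and n_ge_3: "3 \<le> n"
begin

abbreviation nonsink :: "'a set" where "nonsink \<equiv> verts G - {s}"

lemma card_verts: "card (verts G) = n"
  using complete by (simp add: complete_digraph_def)

lemma card_nonsink: "card nonsink = n - 1"
  by (simp add: card_verts sink_in_verts)

lemma dominates_iff: "u \<rightarrow> v \<longleftrightarrow> u \<in> verts G \<and> v \<in> verts G \<and> u \<noteq> v"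
  using complete by (simp add: complete_digraph_def)

lemma deg_eq: "v \<in> verts G \<Longrightarrow> deg v = n - 1"
proof -
  assume "v \<in> verts G"
  then have "{u. v \<rightarrow> u} = verts G - {v}" by (auto simp: dominates_iff)
  with \<open>v \<in> verts G\<close> show ?thesis by (simp add: out_degree_eq_card_dominated card_verts)
qed

lemma topple_eq:
  assumes "v \<in> nonsink"
  shows "topple v \<eta> = (\<lambda>u. if u = v then \<eta> u - (n - 1) else if u \<in> nonsink then \<eta> u + 1 else \<eta> u)"
  using assms by (auto simp: topple_def fun_eq_iff deg_eq dominates_iff)

lemma topplesE:
  assumes "topples \<eta> \<xi>"
  obtains v where "v \<in> nonsink" "n - 1 \<le> \<eta> v" "\<xi> = topple v \<eta>"
  using assms by (auto simp: topples_def deg_eq)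

lemma topplesI: "v \<in> nonsink \<Longrightarrow> n - 1 \<le> \<eta> v \<Longrightarrow> topples \<eta> (topple v \<eta>)"
  by (auto simp: topples_def deg_eq)

lemma stable_iff: "stable \<eta> \<longleftrightarrow> config \<eta> \<and> (\<forall>v \<in> nonsink. \<eta> v < n - 1)"
  by (simp add: stable_def deg_eq)

lemma config_topples: "topples \<eta> \<xi> \<Longrightarrow> config \<eta> \<Longrightarrow> config \<xi>"
  by (auto elim!: topplesE simp: config_def topple_eq)

lemma config_rtopples: "topples\<^sup>*\<^sup>* \<eta> \<xi> \<Longrightarrow> config \<eta> \<Longrightarrow> config \<xi>"
  by (induction rule: rtranclp_induct) (auto intro: config_topples)

lemma stable_no_topple: "stable \<eta> \<Longrightarrow> \<not> topples \<eta> \<xi>"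
  by (metis stable_iff topplesE leD)

lemma stable_rtopples: "stable \<eta> \<Longrightarrow> topples\<^sup>*\<^sup>* \<eta> \<xi> \<Longrightarrow> \<xi> = \<eta>"
  by (metis converse_rtranclpE stable_no_topple)

section \<open>Termination and order independence of toppling\<close>

definition chips :: "('a \<Rightarrow> nat) \<Rightarrow> nat" where
  "chips \<eta> = (\<Sum>v\<in>nonsink. \<eta> v)"

text \<open>Every nonsink vertex of the complete graph is adjacent to the sink, so each toppling
  destroys exactly one chip. This makes \<open>chips\<close> the induction measure for existence and
  uniqueness of the stabilization.\<close>

lemma chips_topple:
  assumes "v \<in> nonsink" "n - 1 \<le> \<eta> v"
  shows "chips \<eta> = Suc (chips (topple v \<eta>))"
proof -
  have fin: "finite nonsink" by simp
  have "chips (topple v \<eta>) = (\<eta> v - (n - 1)) + (\<Sum>u\<in>nonsink - {v}. \<eta> u + 1)"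
    using assms unfolding chips_def topple_eq[OF assms(1)]
    by (subst sum.remove[OF fin assms(1)]) (auto intro!: sum.cong)
  also have "(\<Sum>u\<in>nonsink - {v}. \<eta> u + 1) = (\<Sum>u\<in>nonsink - {v}. \<eta> u) + (n - 2)"
    using assms by (simp only: sum.distrib sum_constant) (simp add: card_verts sink_in_verts)
  finally show ?thesis
    using assms n_ge_3 unfolding chips_def by (subst sum.remove[OF fin assms(1)]) auto
qed

lemma topple_commute:
  assumes "u \<in> nonsink" "v \<in> nonsink" "u \<noteq> v" "n - 1 \<le> \<eta> u" "n - 1 \<le> \<eta> v"
  shows "topple u (topple v \<eta>) = topple v (topple u \<eta>)"
  using assms by (auto simp: topple_eq fun_eq_iff)

lemma topple_other_ge: "u \<in> nonsink \<Longrightarrow> v \<in> nonsink \<Longrightarrow> u \<noteq> v \<Longrightarrow> k \<le> \<eta> u \<Longrightarrow> k \<le> topple v \<eta> u"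
  by (simp add: topple_eq)

lemma stabilizes: "config \<eta> \<Longrightarrow> \<exists>\<xi>. topples\<^sup>*\<^sup>* \<eta> \<xi> \<and> stable \<xi>"
proof (induction "chips \<eta>" arbitrary: \<eta> rule: less_induct)
  case less
  show ?case
  proof (cases "stable \<eta>")
    case False
    then obtain v where v: "v \<in> nonsink" "n - 1 \<le> \<eta> v"
      using less.prems by (auto simp: stable_iff not_less)
    obtain \<xi> where "topples\<^sup>*\<^sup>* (topple v \<eta>) \<xi>" "stable \<xi>"
      using less.hyps[of "topple v \<eta>"] chips_topple[of v \<eta>, OF v] config_topples[OF topplesI[of v \<eta>, OF v] less.prems]
      by auto
    then show ?thesis using topplesI[of v \<eta>, OF v] by (meson converse_rtranclp_into_rtranclp)
  qed auto
qed

text \<open>Diamond argument: two different first topplings commute, because neither takes chips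
  from the vertex of the other, so both branches reach a common configuration. A stable outcome of
  that configuration is compared with each branch by induction on the number of chips.\<close>

lemma stable_unique:
  assumes "config \<eta>" "topples\<^sup>*\<^sup>* \<eta> \<xi>" "stable \<xi>" "topples\<^sup>*\<^sup>* \<eta> \<zeta>" "stable \<zeta>"
  shows "\<xi> = \<zeta>"
  using assms
proof (induction "chips \<eta>" arbitrary: \<eta> \<xi> \<zeta> rule: less_induct)
  case less
  show ?case
  proof (cases "stable \<eta>")
    case True
    then show ?thesis using less.prems stable_rtopples by metis
  next
    case False
    obtain \<xi>1 where x: "topples \<eta> \<xi>1" "topples\<^sup>*\<^sup>* \<xi>1 \<xi>"
      using False less.prems by (metis converse_rtranclpE)
    obtain \<zeta>1 where z: "topples \<eta> \<zeta>1" "topples\<^sup>*\<^sup>* \<zeta>1 \<zeta>"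
      using False less.prems by (metis converse_rtranclpE)
    from x(1) obtain u where u: "u \<in> nonsink" "n - 1 \<le> \<eta> u" "\<xi>1 = topple u \<eta>" by (rule topplesE)
    from z(1) obtain v where v: "v \<in> nonsink" "n - 1 \<le> \<eta> v" "\<zeta>1 = topple v \<eta>" by (rule topplesE)
    have c: "config \<xi>1" "config \<zeta>1" using x z less.prems config_topples by auto
    have lt: "chips \<xi>1 < chips \<eta>" "chips \<zeta>1 < chips \<eta>"
      using chips_topple[of u \<eta>, OF u(1,2)] chips_topple[of v \<eta>, OF v(1,2)] u(3) v(3) by auto
    show ?thesis
    proof (cases "u = v")
      case True
      then show ?thesis using less.hyps[OF lt(1) c(1) x(2) _ _ ] less.prems z u v by auto
    next
      case False
      let ?\<omega> = "topple v \<xi>1"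
      have \<omega>: "topples \<xi>1 ?\<omega>" "topples \<zeta>1 ?\<omega>"
        using topplesI[of v \<xi>1] topplesI[of u \<zeta>1] topple_commute[of u v \<eta>] topple_other_ge u v False by auto
      obtain \<tau> where \<tau>: "topples\<^sup>*\<^sup>* ?\<omega> \<tau>" "stable \<tau>"
        using stabilizes[of ?\<omega>] config_topples[OF \<omega>(1) c(1)] by auto
      have "\<xi> = \<tau>" using less.hyps[OF lt(1) c(1) x(2) _ _ \<tau>(2)] \<omega> \<tau> less.prems
        by (meson converse_rtranclp_into_rtranclp)
      moreover have "\<zeta> = \<tau>" using less.hyps[OF lt(2) c(2) z(2) _ _ \<tau>(2)] \<omega> \<tau> less.prems
        by (meson converse_rtranclp_into_rtranclp)
      ultimately show ?thesis by simp
    qed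
  qed
qed

lemma stabilization_props:
  assumes "config \<eta>"
  shows rtopples_stabilization: "topples\<^sup>*\<^sup>* \<eta> (stabilization \<eta>)"
    and stable_stabilization: "stable (stabilization \<eta>)"
proof -
  have "\<exists>!\<xi>. topples\<^sup>*\<^sup>* \<eta> \<xi> \<and> stable \<xi>"
    using stabilizes[OF assms] stable_unique[OF assms] by blast
  then have "topples\<^sup>*\<^sup>* \<eta> (stabilization \<eta>) \<and> stable (stabilization \<eta>)"
    unfolding stabilization_def by (rule theI')
  then show "topples\<^sup>*\<^sup>* \<eta> (stabilization \<eta>)" "stable (stabilization \<eta>)" by auto
qed

lemma stabilization_rtopples:
  assumes "config \<eta>" "topples\<^sup>*\<^sup>* \<eta> \<xi>"
  shows "stabilization \<xi> = stabilization \<eta>"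
  using assms config_rtopples[OF assms(2,1)]
  by (intro stable_unique[OF assms(1)]) (meson rtranclp_trans stabilization_props)+

lemma stabilization_stable: "stable \<eta> \<Longrightarrow> stabilization \<eta> = \<eta>"
  using stable_rtopples rtopples_stabilization stable_def by blast

lemma topples_add: "topples \<eta> \<xi> \<Longrightarrow> topples (\<lambda>v. \<eta> v + \<zeta> v) (\<lambda>v. \<xi> v + \<zeta> v)"
proof (erule topplesE)
  fix v assume v: "v \<in> nonsink" "n - 1 \<le> \<eta> v" "\<xi> = topple v \<eta>"
  have "(\<lambda>v. \<xi> v + \<zeta> v) = topple v (\<lambda>v. \<eta> v + \<zeta> v)"
    using v by (auto simp: topple_eq fun_eq_iff)
  then show ?thesis using topplesI[of v "\<lambda>v. \<eta> v + \<zeta> v"] v by simp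
qed

lemma rtopples_add: "topples\<^sup>*\<^sup>* \<eta> \<xi> \<Longrightarrow> topples\<^sup>*\<^sup>* (\<lambda>v. \<eta> v + \<zeta> v) (\<lambda>v. \<xi> v + \<zeta> v)"
  by (induction rule: rtranclp_induct) (auto intro: rtranclp.rtrancl_into_rtrancl topples_add)

lemma config_add: "config \<eta> \<Longrightarrow> config \<zeta> \<Longrightarrow> config (\<lambda>v. \<eta> v + \<zeta> v)"
  by (simp add: config_def)

text \<open>Topplings that are legal for \<open>\<eta>\<close> stay legal after chips are added, so
  stabilizing \<open>\<eta>\<close> first is only the beginning of a stabilization of the
  sum.\<close>

lemma stabilization_add:
  assumes "config \<eta>" "config \<zeta>"
  shows "stabilization (\<lambda>v. stabilization \<eta> v + \<zeta> v) = stabilization (\<lambda>v. \<eta> v + \<zeta> v)"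
  by (intro stabilization_rtopples rtopples_add rtopples_stabilization config_add assms)

lemma config_chip: "v \<in> verts G \<Longrightarrow> config (chip v)"
  by (auto simp: config_def chip_def)

section \<open>The burning test and its relation to recurrence\<close>

definition ones :: "'a \<Rightarrow> nat" where
  "ones = (\<lambda>v. if v \<in> nonsink then 1 else 0)"

lemma config_ones: "config ones" by (auto simp: config_def ones_def)

lemma config_max_stable: "config max_stable" by (auto simp: config_def max_stable_def)

text \<open>Dhar's burning test: \<open>ones\<close> is what the sink would send out if it toppled.
  In this form recurrence is easily seen to be preserved by adding chips.\<close>

definition burn_fixed :: "('a \<Rightarrow> nat) set" where
  "burn_fixed = {\<eta>. stable \<eta> \<and> stabilization (\<lambda>v. \<eta> v + ones v) = \<eta>}"

text \<open>Invariant for toppling every vertex once, in any order: a vertex of \<open>S\<close> has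
  lost n - 1 chips and received one from each other member of \<open>S\<close>, while a vertex
  outside \<open>S\<close> has only gained chips and is still ready to topple.\<close>

lemma rtopples_all_once:
  assumes "S \<subseteq> nonsink"
  shows "topples\<^sup>*\<^sup>* (\<lambda>v. max_stable v + ones v)
     (\<lambda>v. if v \<in> nonsink then (if v \<in> S then card S - 1 else n - 1 + card S) else 0)"
  using finite_subset[OF assms finite_Diff[OF finite_verts]] assms
proof (induction S rule: finite_induct)
  case empty
  have "(\<lambda>v. max_stable v + ones v) = (\<lambda>v. if v \<in> nonsink then n - 1 else 0)"
    using n_ge_3 by (auto simp: max_stable_def ones_def deg_eq fun_eq_iff)
  then show ?case by (simp cong: if_cong)
next
  case (insert x S)
  let ?f = "\<lambda>S v. if v \<in> nonsink then (if v \<in> S then card S - 1 else n - 1 + card S) else 0"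
  have x: "x \<in> nonsink" using insert by auto
  \<comment> \<open>A member makes \<open>card S\<close> positive, so the truncated
    \<open>card S - 1\<close> really increases to \<open>card S\<close> when \<open>x\<close>
    topples.\<close>
  have pos: "0 < card S" if "v \<in> S" for v using that insert(1) by (auto simp: card_gt_0_iff)
  have "topple x (?f S) = ?f (insert x S)"
    using x insert pos by (auto simp: topple_eq fun_eq_iff)
  moreover have "topples (?f S) (topple x (?f S))"
    using x insert by (intro topplesI) auto
  ultimately show ?case using insert by (metis (no_types, lifting) insert_subset rtranclp.rtrancl_into_rtrancl)
qed

lemma rtopples_max_stable_ones: "topples\<^sup>*\<^sup>* (\<lambda>v. max_stable v + ones v) max_stable"
proof -
  have "max_stable = (\<lambda>v. if v \<in> nonsink then (if v \<in> nonsink then card nonsink - 1 else n - 1 + card nonsink) else 0)"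
    by (auto simp: max_stable_def deg_eq card_nonsink fun_eq_iff)
  then show ?thesis using rtopples_all_once[of nonsink] by simp
qed

text \<open>The burning chips can be absorbed before \<open>\<sigma>\<close> is added, since
  \<open>max_stable\<close> plus \<open>ones\<close> topples back to
  \<open>max_stable\<close>.\<close>

lemma recurrent_subset_burn_fixed: "recurrent \<subseteq> burn_fixed"
proof
  fix \<eta> assume "\<eta> \<in> recurrent"
  then obtain \<sigma> where s: "stable \<sigma>" "stable \<eta>" and e: "\<eta> = stabilization (\<lambda>v. max_stable v + \<sigma> v)"
    by (auto simp: recurrent_def sandpile_add_def)
  have c: "config \<sigma>" using s by (simp add: stable_def)
  have "stabilization (\<lambda>v. \<eta> v + ones v) = stabilization (\<lambda>v. (max_stable v + \<sigma> v) + ones v)"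
    unfolding e by (intro stabilization_add config_add config_max_stable config_ones c)
  also have "\<dots> = stabilization (\<lambda>v. (max_stable v + ones v) + \<sigma> v)"
    by (simp add: ac_simps)
  also have "\<dots> = \<eta>" unfolding e
    by (rule stabilization_rtopples[symmetric])
      (intro config_add config_max_stable config_ones c rtopples_add rtopples_max_stable_ones)+
  finally show "\<eta> \<in> burn_fixed" using s by (simp add: burn_fixed_def)
qed

lemma burn_fixed_add:
  assumes "\<eta> \<in> burn_fixed" "config \<zeta>"
  shows "stabilization (\<lambda>v. \<eta> v + \<zeta> v) \<in> burn_fixed"
proof -
  have c: "config \<eta>" using assms by (simp add: burn_fixed_def stable_def)
  have "stabilization (\<lambda>v. stabilization (\<lambda>v. \<eta> v + \<zeta> v) v + ones v) = stabilization (\<lambda>v. (\<eta> v + \<zeta> v) + ones v)"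
    by (intro stabilization_add config_add config_ones c assms)
  also have "\<dots> = stabilization (\<lambda>v. (\<eta> v + ones v) + \<zeta> v)" by (simp add: ac_simps)
  also have "\<dots> = stabilization (\<lambda>v. stabilization (\<lambda>v. \<eta> v + ones v) v + \<zeta> v)"
    by (intro stabilization_add[symmetric] config_add config_ones c assms)
  also have "\<dots> = stabilization (\<lambda>v. \<eta> v + \<zeta> v)" using assms by (simp add: burn_fixed_def)
  finally show ?thesis
    by (simp add: burn_fixed_def stable_stabilization config_add c assms)
qed

section \<open>Classification of the recurrent states by residues modulo n\<close>

definition neutral :: "('a \<Rightarrow> nat) \<Rightarrow> bool" where
  "neutral \<zeta> \<longleftrightarrow> config \<zeta> \<and> (\<forall>\<eta> \<in> burn_fixed. stabilization (\<lambda>v. \<eta> v + \<zeta> v) = \<eta>)"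

lemma neutral_zero: "neutral (\<lambda>_. 0)"
  by (simp add: neutral_def config_def burn_fixed_def stabilization_stable)

lemma neutral_add:
  assumes "neutral \<zeta>" "neutral \<xi>"
  shows "neutral (\<lambda>v. \<zeta> v + \<xi> v)"
  unfolding neutral_def
proof (intro conjI ballI)
  show "config (\<lambda>v. \<zeta> v + \<xi> v)" using assms by (simp add: neutral_def config_add)
  fix \<eta> assume \<eta>: "\<eta> \<in> burn_fixed"
  then have c: "config \<eta>" by (simp add: burn_fixed_def stable_def)
  have "stabilization (\<lambda>v. (\<eta> v + \<zeta> v) + \<xi> v) = stabilization (\<lambda>v. stabilization (\<lambda>v. \<eta> v + \<zeta> v) v + \<xi> v)"
    using assms by (intro stabilization_add[symmetric] config_add c) (auto simp: neutral_def)
  also have "\<dots> = \<eta>" using assms \<eta> by (simp add: neutral_def)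
  finally show "stabilization (\<lambda>v. \<eta> v + (\<zeta> v + \<xi> v)) = \<eta>" by (simp add: ac_simps)
qed

lemma neutral_scale: "neutral \<zeta> \<Longrightarrow> neutral (\<lambda>v. k * \<zeta> v)"
proof (induction k)
  case 0 show ?case using neutral_zero by simp
next
  case (Suc k)
  then show ?case using neutral_add[of \<zeta> "\<lambda>v. k * \<zeta> v"] by simp
qed

lemma neutral_sum: "finite S \<Longrightarrow> (\<And>x. x \<in> S \<Longrightarrow> neutral (f x)) \<Longrightarrow> neutral (\<lambda>v. \<Sum>x\<in>S. f x v)"
  by (induction S rule: finite_induct) (simp_all add: neutral_zero neutral_add)

lemma neutral_ones: "neutral ones"
  by (auto simp: neutral_def config_ones burn_fixed_def)

text \<open>Toppling \<open>v\<close> once turns \<open>n\<close> extra chips at \<open>v\<close> into one extra chip everywhere.\<close>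
lemma neutral_n_at:
  assumes "v \<in> nonsink"
  shows "neutral (\<lambda>u. if u = v then n else 0)"
  unfolding neutral_def
proof (intro conjI ballI)
  show c0: "config (\<lambda>u. if u = v then n else 0)" using assms by (auto simp: config_def)
  fix \<eta> assume \<eta>: "\<eta> \<in> burn_fixed"
  let ?\<xi> = "\<lambda>u. \<eta> u + (if u = v then n else 0)"
  have "topple v ?\<xi> = (\<lambda>u. \<eta> u + ones u)"
    using assms n_ge_3 by (auto simp: topple_eq[OF assms] ones_def fun_eq_iff)
  moreover have "topples ?\<xi> (topple v ?\<xi>)" using assms by (intro topplesI) auto
  moreover have "config ?\<xi>" using c0 \<eta> by (intro config_add) (auto simp: burn_fixed_def stable_def)
  ultimately have "stabilization (\<lambda>u. \<eta> u + ones u) = stabilization ?\<xi>"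
    by (metis r_into_rtranclp stabilization_rtopples)
  with \<eta> show "stabilization ?\<xi> = \<eta>" by (simp add: burn_fixed_def)
qed

lemma neutral_multiple_n:
  "neutral (\<lambda>u. if u \<in> nonsink then n * z u else 0)"
proof -
  have "neutral (\<lambda>u. \<Sum>v\<in>nonsink. z v * (if u = v then n else 0))"
    by (intro neutral_sum neutral_scale neutral_n_at) auto
  also have "(\<lambda>u. \<Sum>v\<in>nonsink. z v * (if u = v then n else 0)) = (\<lambda>u. if u \<in> nonsink then n * z u else 0)"
    by (rule ext) (auto simp: if_distrib[of "(*) _"] sum.delta cong: if_cong)
  finally show ?thesis .
qed

text \<open>Congruence of the coordinate differences, written with crossed sums because subtraction
  of naturals truncates.\<close>

definition residue_equiv :: "('a \<Rightarrow> nat) \<Rightarrow> ('a \<Rightarrow> nat) \<Rightarrow> bool" where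
  "residue_equiv \<eta> \<xi> \<longleftrightarrow> (\<forall>u\<in>nonsink. \<forall>v\<in>nonsink. (\<eta> u + \<xi> v) mod n = (\<xi> u + \<eta> v) mod n)"

text \<open>Equivalent states differ by an integer combination of \<open>ones\<close> and of n chips
  at single vertices. With the negative multiples moved to the other side, a neutral configuration
  is added to each state so that the two sums coincide; stabilizing then returns both
  states.\<close>

lemma burn_fixed_eqI:
  assumes "\<eta> \<in> burn_fixed" "\<xi> \<in> burn_fixed" "residue_equiv \<eta> \<xi>"
  shows "\<eta> = \<xi>"
proof -
  have "card nonsink > 0" using n_ge_3 card_nonsink by simp
  then obtain w where w: "w \<in> nonsink" by (auto simp: card_gt_0_iff)
  have c: "config \<eta>" "config \<xi>" using assms by (auto simp: burn_fixed_def stable_def)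
  \<comment> \<open>Anchored at \<open>w\<close>, the functions \<open>a\<close> and
    \<open>b\<close> agree modulo n, so adding to each n times the quotient of the other makes them
    equal.\<close>
  define a where "a = (\<lambda>u. \<eta> u + \<xi> w)"
  define b where "b = (\<lambda>u. \<xi> u + \<eta> w)"
  have eq: "\<eta> u + (\<xi> w * ones u + (if u \<in> nonsink then n * (b u div n) else 0))
          = \<xi> u + (\<eta> w * ones u + (if u \<in> nonsink then n * (a u div n) else 0))" for u
  proof (cases "u \<in> nonsink")
    case True
    then have "a u mod n = b u mod n" using assms(3) w by (auto simp: residue_equiv_def a_def b_def)
    then have "a u + n * (b u div n) = b u + n * (a u div n)"
      by (metis add.commute add.left_commute mult_div_mod_eq)
    then show ?thesis using True by (simp add: a_def b_def ones_def)
  next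
    case False
    then show ?thesis using c by (auto simp: config_def ones_def)
  qed
  have "neutral (\<lambda>u. \<xi> w * ones u + (if u \<in> nonsink then n * (b u div n) else 0))"
       "neutral (\<lambda>u. \<eta> w * ones u + (if u \<in> nonsink then n * (a u div n) else 0))"
    by (intro neutral_add neutral_scale neutral_ones neutral_multiple_n)+
  with assms have "\<eta> = stabilization (\<lambda>u. \<eta> u + (\<xi> w * ones u + (if u \<in> nonsink then n * (b u div n) else 0)))"
    "\<xi> = stabilization (\<lambda>u. \<xi> u + (\<eta> w * ones u + (if u \<in> nonsink then n * (a u div n) else 0)))"
    by (auto simp: neutral_def)
  then show ?thesis by (simp only: eq)
qed

text \<open>Losing n - 1 chips is gaining one chip modulo n, so all nonsink coordinates increase by
  1 modulo n and their differences are unchanged.\<close>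

lemma residue_equiv_topples: "topples \<eta> \<xi> \<Longrightarrow> residue_equiv \<eta> \<xi>"
proof (erule topplesE)
  fix v assume v: "v \<in> nonsink" "n - 1 \<le> \<eta> v" "\<xi> = topple v \<eta>"
  have e: "\<xi> v + n = \<eta> v + 1" using v n_ge_3 by (auto simp: topple_eq)
  have o: "\<xi> u = \<eta> u + 1" if "u \<in> nonsink" "u \<noteq> v" for u using v that by (auto simp: topple_eq)
  have m: "\<exists>k. \<xi> u + n * k = \<eta> u + 1" if "u \<in> nonsink" for u
  proof (cases "u = v")
    case True
    then show ?thesis using e by (intro exI[of _ 1]) simp
  next
    case False
    then show ?thesis using o[OF that] by (intro exI[of _ 0]) simp
  qed
  have "(\<eta> u + \<xi> w) mod n = (\<xi> u + \<eta> w) mod n" if uw: "u \<in> nonsink" "w \<in> nonsink" for u w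
  proof -
    obtain k l where "\<xi> u + n * k = \<eta> u + 1" "\<xi> w + n * l = \<eta> w + 1" using m uw by meson
    then have "(\<eta> u + \<xi> w) + n * l = (\<xi> u + \<eta> w) + n * k" by linarith
    then show ?thesis by (metis mod_mult_self2)
  qed
  then show "residue_equiv \<eta> \<xi>" by (simp add: residue_equiv_def)
qed

lemma residue_equiv_iff_cong:
  "residue_equiv \<eta> \<xi> \<longleftrightarrow>
     (\<forall>u\<in>nonsink. \<forall>v\<in>nonsink. (int (\<eta> u) - int (\<eta> v)) mod int n = (int (\<xi> u) - int (\<xi> v)) mod int n)"
proof -
  have "(\<eta> u + \<xi> v) mod n = (\<xi> u + \<eta> v) mod n \<longleftrightarrow>
      (int (\<eta> u) - int (\<eta> v)) mod int n = (int (\<xi> u) - int (\<xi> v)) mod int n" for u v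
  proof -
    have "(\<eta> u + \<xi> v) mod n = (\<xi> u + \<eta> v) mod n \<longleftrightarrow>
        (int (\<eta> u) + int (\<xi> v)) mod int n = (int (\<xi> u) + int (\<eta> v)) mod int n"
      by (metis of_nat_add of_nat_eq_iff of_nat_mod)
    also have "\<dots> \<longleftrightarrow> (int (\<eta> u) - int (\<eta> v)) mod int n = (int (\<xi> u) - int (\<xi> v)) mod int n"
      by (simp add: mod_eq_dvd_iff algebra_simps)
    finally show ?thesis .
  qed
  then show ?thesis by (simp add: residue_equiv_def)
qed

lemma residue_equiv_trans: "residue_equiv \<eta> \<xi> \<Longrightarrow> residue_equiv \<xi> \<zeta> \<Longrightarrow> residue_equiv \<eta> \<zeta>"
  by (simp add: residue_equiv_iff_cong)

lemma residue_equiv_rtopples: "topples\<^sup>*\<^sup>* \<eta> \<xi> \<Longrightarrow> residue_equiv \<eta> \<xi>"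
  by (induction rule: rtranclp_induct)
    (simp add: residue_equiv_def, blast intro: residue_equiv_trans residue_equiv_topples)

text \<open>By the pigeonhole principle some shift \<open>k\<close> keeps every coordinate of
  \<open>\<eta> - max_stable + k\<close> different from \<open>n - 1\<close> modulo \<open>n\<close>.\<close>
lemma recurrent_representative:
  fixes \<eta> :: "'a \<Rightarrow> nat"
  shows "\<exists>\<xi> \<in> recurrent. residue_equiv \<eta> \<xi>"
proof -
  \<comment> \<open>The 2 is -(n - 2) modulo n, where n - 2 is the value of
    \<open>max_stable\<close>. The only shift below n that brings coordinate \<open>u\<close> to n -
    1 is \<open>?h u\<close>, and there are n shifts but only n - 1 coordinates.\<close>
  let ?h = "\<lambda>u. n - 1 - (\<eta> u + 2) mod n"
  have "card (?h ` nonsink) \<le> n - 1" using card_image_le[of nonsink ?h] card_nonsink by simp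
  also have "\<dots> < card {..<n}" using n_ge_3 by simp
  finally have "\<not> {..<n} \<subseteq> ?h ` nonsink" using card_mono[of "?h ` nonsink" "{..<n}"] by auto
  then obtain k where k: "k < n" "k \<notin> ?h ` nonsink" by blast
  define \<sigma> where "\<sigma> = (\<lambda>u. if u \<in> nonsink then (\<eta> u + 2 + k) mod n else 0)"
  have "(\<eta> u + 2 + k) mod n < n - 1" if u: "u \<in> nonsink" for u
  proof (rule ccontr)
    define r where "r = (\<eta> u + 2) mod n"
    have r: "r < n" using n_ge_3 by (simp add: r_def)
    have eq: "(\<eta> u + 2 + k) mod n = (r + k) mod n" unfolding r_def by (simp only: mod_add_left_eq)
    have "(r + k) mod n < n" using r by simp
    moreover assume "\<not> (\<eta> u + 2 + k) mod n < n - 1"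
    ultimately have "(r + k) mod n = n - 1" unfolding eq by linarith
    moreover have "(r + k) mod n = (if r + k < n then r + k else r + k - n)"
      using r k by (cases "r + k < n") (simp_all add: le_mod_geq)
    ultimately have "k = n - 1 - r" using r k by (auto split: if_splits)
    then have "k = ?h u" unfolding r_def .
    then show False using k(2) u by blast
  qed
  then have st: "stable \<sigma>" by (auto simp: stable_iff config_def \<sigma>_def)
  let ?x = "\<lambda>v. max_stable v + \<sigma> v"
  have c: "config ?x" using st by (intro config_add config_max_stable) (simp add: stable_def)
  have "residue_equiv \<eta> ?x"
    unfolding residue_equiv_def
  proof (intro ballI)
    fix u v assume uv: "u \<in> nonsink" "v \<in> nonsink"
    have e: "?x u = (n - 2) + (\<eta> u + 2 + k) mod n" if "u \<in> nonsink" for u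
      using that by (auto simp: max_stable_def deg_eq \<sigma>_def)
    have "(\<eta> u + ?x v) mod n = (\<eta> u + ((n - 2) + (\<eta> v + 2 + k))) mod n"
      unfolding e[OF uv(2)] by (metis mod_add_right_eq)
    also have "\<dots> = (((n - 2) + (\<eta> u + 2 + k)) + \<eta> v) mod n" by (simp add: ac_simps)
    also have "\<dots> = (?x u + \<eta> v) mod n"
      unfolding e[OF uv(1)] by (metis mod_add_right_eq mod_add_left_eq)
    finally show "(\<eta> u + ?x v) mod n = (?x u + \<eta> v) mod n" .
  qed
  then have "residue_equiv \<eta> (stabilization ?x)"
    using residue_equiv_trans residue_equiv_rtopples[OF rtopples_stabilization[OF c]] by blast
  moreover have "stabilization ?x \<in> recurrent"
    using st stable_stabilization[OF c] by (auto simp: recurrent_def sandpile_add_def)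
  ultimately show ?thesis by blast
qed

text \<open>A state passing the burning test is equivalent to some recurrent state, which passes the
  test as well; a residue class contains at most one such state, so the two are equal.\<close>

lemma recurrent_eq_burn_fixed: "recurrent = burn_fixed"
proof
  show "burn_fixed \<subseteq> recurrent"
    using recurrent_representative burn_fixed_eqI recurrent_subset_burn_fixed by (metis subset_iff)
qed (rule recurrent_subset_burn_fixed)

lemma recurrent_nonempty: "recurrent \<noteq> {}"
  using recurrent_representative by blast

lemma recurrent_config: "\<eta> \<in> recurrent \<Longrightarrow> config \<eta>"
  by (simp add: recurrent_def stable_def)

lemma recurrent_eqI: "\<eta> \<in> recurrent \<Longrightarrow> \<xi> \<in> recurrent \<Longrightarrow> residue_equiv \<eta> \<xi> \<Longrightarrow> \<eta> = \<xi>"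
  by (simp add: recurrent_eq_burn_fixed burn_fixed_eqI)

lemma recurrent_add_chip:
  "\<eta> \<in> recurrent \<Longrightarrow> v \<in> verts G \<Longrightarrow> stabilization (\<lambda>u. \<eta> u + chip v u) \<in> recurrent"
  by (simp add: recurrent_eq_burn_fixed burn_fixed_add config_chip)

end

section \<open>Characters and eigenvalues\<close>

definition zeta :: "nat \<Rightarrow> int \<Rightarrow> complex" where
  "zeta n x = cis (2 * pi * of_int x / of_nat n)"

lemma zeta_0 [simp]: "zeta n 0 = 1"
  by (simp add: zeta_def)

lemma zeta_add: "zeta n (x + y) = zeta n x * zeta n y"
  by (simp add: zeta_def cis_mult add_divide_distrib distrib_left)

lemma zeta_uminus: "zeta n (- x) = cnj (zeta n x)"
  by (simp add: zeta_def cis_cnj)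

lemma zeta_diff: "zeta n (x - y) = zeta n x * cnj (zeta n y)"
  using zeta_add[of n x "- y"] by (simp add: zeta_uminus)

lemma norm_zeta [simp]: "cmod (zeta n x) = 1"
  by (simp add: zeta_def)

lemma zeta_mult_cnj [simp]: "zeta n x * cnj (zeta n x) = 1" "cnj (zeta n x) * zeta n x = 1"
  using zeta_diff[of n x x] by (simp_all add: mult.commute)

lemma zeta_eq_1_iff:
  assumes "n > 0"
  shows "zeta n x = 1 \<longleftrightarrow> int n dvd x"
proof -
  have "zeta n x = 1 \<longleftrightarrow> (\<exists>k. 2 * pi * real_of_int x / real n = real_of_int k * (2 * pi))"
    by (simp add: zeta_def cis_eq_1_iff)
  also have "\<dots> \<longleftrightarrow> (\<exists>k. real_of_int x = real_of_int (k * int n))"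
    using assms by (intro ex_cong1) (simp add: field_simps)
  also have "\<dots> \<longleftrightarrow> int n dvd x"
    unfolding of_int_eq_iff by (auto simp: dvd_def mult.commute)
  finally show ?thesis .
qed

lemma zeta_cong:
  assumes "n > 0" "int n dvd x - y"
  shows "zeta n x = zeta n y"
  using zeta_add[of n "x - y" y] assms by (simp add: zeta_eq_1_iff[symmetric])

lemma zeta_mod [simp]: "n > 0 \<Longrightarrow> zeta n (x mod int n) = zeta n x"
  by (rule zeta_cong) (simp_all add: minus_mod_eq_mult_div[symmetric] minus_mod_eq_mult_div dvd_def, metis minus_mod_eq_mult_div mult_minus_right minus_diff_eq)

context complete_sandpile
begin

section \<open>Characters as eigenfunctions of the chain\<close>

lemma n_pos: "n > 0" using n_ge_3 by simp

text \<open>Divisibility of the sum makes \<open>chi j\<close> invariant under toppling;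
  \<open>j s = 0\<close> gives a chip dropped into the sink the factor 1.\<close>

definition balanced :: "('a \<Rightarrow> int) \<Rightarrow> bool" where
  "balanced j \<longleftrightarrow> j s = 0 \<and> int n dvd (\<Sum>v\<in>verts G. j v)"

definition pairing :: "('a \<Rightarrow> int) \<Rightarrow> ('a \<Rightarrow> nat) \<Rightarrow> int" where
  "pairing j \<eta> = (\<Sum>v\<in>nonsink. j v * int (\<eta> v))"

definition chi :: "('a \<Rightarrow> int) \<Rightarrow> ('a \<Rightarrow> nat) \<Rightarrow> complex" where
  "chi j \<eta> = zeta n (pairing j \<eta>)"

definition eigenvalue :: "('a \<Rightarrow> int) \<Rightarrow> complex" where
  "eigenvalue j = (\<Sum>v\<in>verts G. zeta n (j v)) / of_nat n"

lemma norm_chi [simp]: "cmod (chi j \<eta>) = 1"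
  by (simp add: chi_def)

lemma chi_mult_cnj [simp]: "chi j \<eta> * cnj (chi j \<eta>) = 1"
  by (simp add: chi_def)

lemma balanced_nonsink: "balanced j \<Longrightarrow> int n dvd (\<Sum>v\<in>nonsink. j v)"
  by (metis balanced_def add_0 sum.remove[OF finite_verts sink_in_verts])

lemma pairing_add: "pairing j (\<lambda>u. \<eta> u + \<xi> u) = pairing j \<eta> + pairing j \<xi>"
  by (simp add: pairing_def algebra_simps sum.distrib)

lemma pairing_chip: "j s = 0 \<Longrightarrow> v \<in> verts G \<Longrightarrow> pairing j (chip v) = j v"
proof -
  assume a: "j s = 0" "v \<in> verts G"
  have "pairing j (chip v) = (\<Sum>u\<in>nonsink. if u = v then j v else 0)"
    unfolding pairing_def by (rule sum.cong) (use a in \<open>auto simp: chip_def\<close>)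
  with a show ?thesis by (auto simp: sum.delta)
qed

text \<open>A toppling adds 1 at every nonsink vertex and removes n at one of them, so the pairing
  changes by the sum of \<open>j\<close> minus a multiple of n.\<close>

lemma chi_topples:
  assumes "balanced j" "topples \<eta> \<xi>"
  shows "chi j \<xi> = chi j \<eta>"
proof -
  from assms(2) obtain v where v: "v \<in> nonsink" "n - 1 \<le> \<eta> v" "\<xi> = topple v \<eta>" by (rule topplesE)
  have e: "int (\<xi> u) = int (\<eta> u) + 1 - (if u = v then int n else 0)" if "u \<in> nonsink" for u
    using v that n_ge_3 by (auto simp: topple_eq)
  have "pairing j \<xi> = (\<Sum>u\<in>nonsink. j u * int (\<eta> u) + j u - (if u = v then j u * int n else 0))"
    unfolding pairing_def by (intro sum.cong refl, subst e) (simp_all add: algebra_simps)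
  also have "\<dots> = pairing j \<eta> + (\<Sum>u\<in>nonsink. j u) - j v * int n"
    using v by (simp add: pairing_def sum.distrib sum_subtractf sum.delta)
  finally have "pairing j \<xi> - pairing j \<eta> = (\<Sum>u\<in>nonsink. j u) - j v * int n" by simp
  then have "int n dvd pairing j \<xi> - pairing j \<eta>"
    using balanced_nonsink[OF assms(1)] by (simp only: dvd_diff dvd_triv_right)
  then show ?thesis unfolding chi_def by (intro zeta_cong n_pos)
qed

lemma chi_stabilization:
  assumes "balanced j" "config \<eta>"
  shows "chi j (stabilization \<eta>) = chi j \<eta>"
proof -
  have "topples\<^sup>*\<^sup>* \<eta> \<xi> \<Longrightarrow> chi j \<xi> = chi j \<eta>" for \<xi>
    by (induction rule: rtranclp_induct) (simp_all add: chi_topples[OF assms(1)])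
  then show ?thesis using rtopples_stabilization[OF assms(2)] .
qed

lemma chi_add_chip:
  assumes "balanced j" "\<eta> \<in> recurrent" "v \<in> verts G"
  shows "chi j (stabilization (\<lambda>u. \<eta> u + chip v u)) = zeta n (j v) * chi j \<eta>"
proof -
  have "chi j (stabilization (\<lambda>u. \<eta> u + chip v u)) = chi j (\<lambda>u. \<eta> u + chip v u)"
    using assms by (intro chi_stabilization config_add config_chip recurrent_config)
  then show ?thesis
    using assms by (simp add: chi_def pairing_add pairing_chip zeta_add balanced_def mult.commute)
qed

lemma verts_nonempty: "verts G \<noteq> {}" using sink_in_verts by auto

lemma set_chain_step: "\<eta> \<in> recurrent \<Longrightarrow> set_pmf (chain_step \<eta>) \<subseteq> recurrent"
  by (auto simp: chain_step_def set_pmf_of_set[OF verts_nonempty finite_verts] recurrent_add_chip)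

lemma set_chain_dist: "\<sigma> \<in> recurrent \<Longrightarrow> set_pmf (chain_dist \<sigma> t) \<subseteq> recurrent"
  by (induction t) (use set_chain_step in fastforce)+

text \<open>A chip at \<open>v\<close> multiplies the character by \<open>zeta n (j v)\<close>;
  averaging over \<open>v\<close> produces one factor \<open>eigenvalue j\<close> per step.\<close>

lemma expectation_chi:
  assumes "balanced j" "\<sigma> \<in> recurrent"
  shows "measure_pmf.expectation (chain_dist \<sigma> t) (chi j) = eigenvalue j ^ t * chi j \<sigma>"
proof (induction t)
  case 0
  show ?case by (simp add: chi_def)
next
  case (Suc t)
  let ?P = "chain_dist \<sigma> t"
  have step: "measure_pmf.expectation (chain_step \<eta>) (chi j) = eigenvalue j * chi j \<eta>"
    if "\<eta> \<in> recurrent" for \<eta>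
  proof -
    have "measure_pmf.expectation (chain_step \<eta>) (chi j)
        = (\<Sum>v\<in>verts G. chi j (stabilization (\<lambda>u. \<eta> u + chip v u)) /\<^sub>R real n)"
      unfolding chain_step_def integral_map_pmf
      by (subst integral_measure_pmf[OF finite_verts])
        (simp_all add: set_pmf_of_set[OF verts_nonempty finite_verts] pmf_of_set[OF verts_nonempty finite_verts] card_verts field_simps)
    also have "\<dots> = (\<Sum>v\<in>verts G. zeta n (j v) * chi j \<eta> /\<^sub>R real n)"
      by (intro sum.cong refl) (simp add: chi_add_chip[OF assms(1) that])
    also have "\<dots> = eigenvalue j * chi j \<eta>"
      by (simp add: eigenvalue_def sum_divide_distrib sum_distrib_left scaleR_conv_of_real field_simps)
    finally show ?thesis .
  qed
  have sub: "set_pmf ?P \<subseteq> recurrent" by (rule set_chain_dist[OF assms(2)])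
  have "measure_pmf.expectation (chain_dist \<sigma> (Suc t)) (chi j)
      = (\<Sum>\<eta>\<in>recurrent. pmf ?P \<eta> *\<^sub>R measure_pmf.expectation (chain_step \<eta>) (chi j))"
    unfolding chain_dist.simps
    by (rule pmf_expectation_bind[OF finite_recurrent])
      (use sub set_chain_step finite_recurrent in \<open>auto intro: finite_subset\<close>)
  also have "\<dots> = (\<Sum>\<eta>\<in>recurrent. eigenvalue j * (pmf ?P \<eta> *\<^sub>R chi j \<eta>))"
    by (intro sum.cong refl) (simp add: step)
  also have "\<dots> = eigenvalue j * measure_pmf.expectation ?P (chi j)"
    by (subst integral_measure_pmf[OF finite_recurrent]) (use sub in \<open>auto simp: sum_distrib_left\<close>)
  finally show ?case using Suc by simp
qed

lemma sum_pmf_chi: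
  assumes "balanced j" "\<sigma> \<in> recurrent"
  shows "(\<Sum>\<eta>\<in>recurrent. of_real (pmf (chain_dist \<sigma> t) \<eta>) * chi j \<eta>) = eigenvalue j ^ t * chi j \<sigma>"
  using expectation_chi[OF assms, of t] set_chain_dist[OF assms(2), of t]
  by (subst (asm) integral_measure_pmf[OF finite_recurrent]) (auto simp: scaleR_conv_of_real)

section \<open>Orthogonality relations, Parseval's identity and the resulting bound\<close>

lemma add_chip_bij:
  assumes "v \<in> verts G"
  shows "bij_betw (\<lambda>\<eta>. stabilization (\<lambda>u. \<eta> u + chip v u)) recurrent recurrent"
proof -
  let ?f = "\<lambda>\<eta>. stabilization (\<lambda>u. \<eta> u + chip v u)"
  have "inj_on ?f recurrent"
  proof (rule inj_onI)
    fix \<eta> \<xi> assume r: "\<eta> \<in> recurrent" "\<xi> \<in> recurrent" and e: "?f \<eta> = ?f \<xi>"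
    have "config (\<lambda>u. \<eta> u + chip v u)" "config (\<lambda>u. \<xi> u + chip v u)"
      using r assms by (simp_all add: config_add config_chip recurrent_config)
    then have "residue_equiv (\<lambda>u. \<eta> u + chip v u) (?f \<eta>)" "residue_equiv (\<lambda>u. \<xi> u + chip v u) (?f \<xi>)"
      by (simp_all add: residue_equiv_rtopples rtopples_stabilization)
    then have "residue_equiv (\<lambda>u. \<eta> u + chip v u) (\<lambda>u. \<xi> u + chip v u)"
      using e by (simp add: residue_equiv_iff_cong)
    then have "residue_equiv \<eta> \<xi>"
      by (simp add: residue_equiv_iff_cong mod_eq_dvd_iff algebra_simps)
    then show "\<eta> = \<xi>" using r recurrent_eqI by blast
  qed
  moreover have "?f ` recurrent \<subseteq> recurrent" using recurrent_add_chip assms by auto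
  ultimately show ?thesis
    using endo_inj_surj[OF finite_recurrent] by (auto simp: bij_betw_def)
qed

text \<open>Adding a chip at \<open>v\<close> permutes the recurrent states and multiplies the
  character by a root of unity other than 1, so the sum is a nontrivial multiple of itself.\<close>

lemma sum_chi_recurrent:
  assumes "balanced j" "v \<in> verts G" "\<not> int n dvd j v"
  shows "(\<Sum>\<eta>\<in>recurrent. chi j \<eta>) = 0"
proof -
  have "(\<Sum>\<eta>\<in>recurrent. chi j \<eta>) = (\<Sum>\<eta>\<in>recurrent. chi j (stabilization (\<lambda>u. \<eta> u + chip v u)))"
    by (rule sum.reindex_bij_betw[OF add_chip_bij[OF assms(2)], symmetric])
  also have "\<dots> = zeta n (j v) * (\<Sum>\<eta>\<in>recurrent. chi j \<eta>)"
    by (simp add: sum_distrib_left chi_add_chip assms)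
  finally have "(1 - zeta n (j v)) * (\<Sum>\<eta>\<in>recurrent. chi j \<eta>) = 0"
    by (simp add: algebra_simps)
  then show ?thesis using assms(3) zeta_eq_1_iff[OF n_pos] by auto
qed

text \<open>Reduced residues and extensional functions leave a finite set with one representative of
  each class of exponents modulo n.\<close>

definition duals :: "('a \<Rightarrow> int) set" where
  "duals = {j \<in> verts G \<rightarrow>\<^sub>E {0..<int n}. balanced j}"

lemma finite_duals: "finite duals"
  unfolding duals_def by (rule finite_subset[OF _ finite_PiE[OF finite_verts, of "\<lambda>_. {0..<int n}"]]) auto

definition trivial_dual :: "'a \<Rightarrow> int" where
  "trivial_dual = (\<lambda>v\<in>verts G. 0)"

lemma trivial_dual_in: "trivial_dual \<in> duals"
  using n_pos sink_in_verts by (auto simp: duals_def trivial_dual_def balanced_def)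

lemma chi_trivial: "chi trivial_dual \<eta> = 1"
  by (simp add: chi_def pairing_def trivial_dual_def)

lemma nontrivial_dual:
  assumes "j \<in> duals" "j \<noteq> trivial_dual"
  obtains v where "v \<in> verts G" "\<not> int n dvd j v"
proof -
  from assms obtain v where v: "v \<in> verts G" "j v \<noteq> 0"
    by (auto simp: duals_def trivial_dual_def fun_eq_iff PiE_def extensional_def split: if_splits)
  then have "j v \<in> {0..<int n}" using assms by (auto simp: duals_def)
  then have "\<not> int n dvd j v" using v by (auto dest: zdvd_imp_le)
  with v that show ?thesis by blast
qed

text \<open>If \<open>\<eta>\<close> and \<open>\<xi>\<close> are inequivalent, their difference takes incongruent values at two vertices
  \<open>u\<close> and \<open>v\<close>, and shifting \<open>j\<close> by \<open>\<delta>\<^sub>u - \<delta>\<^sub>v\<close> multiplies the sum by a root of unity other than 1.\<close>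
lemma sum_duals_orthogonal:
  assumes "\<eta> \<in> recurrent" "\<xi> \<in> recurrent" "\<eta> \<noteq> \<xi>"
  shows "(\<Sum>j\<in>duals. chi j \<eta> * cnj (chi j \<xi>)) = 0"
proof -
  define d where "d = (\<lambda>v. int (\<eta> v) - int (\<xi> v))"
  define p where "p = (\<lambda>j. \<Sum>w\<in>nonsink. j w * d w)"
  obtain u v where uv: "u \<in> nonsink" "v \<in> nonsink" "\<not> int n dvd d u - d v"
    using recurrent_eqI[of \<eta> \<xi>] assms
    by (auto simp: residue_equiv_iff_cong mod_eq_dvd_iff d_def algebra_simps)
  then have "u \<noteq> v" by auto
  define shift where "shift = (\<lambda>(e::int) j w. if w \<in> verts G then
      (if w = u then (j w + e) mod int n else if w = v then (j w - e) mod int n else j w) else undefined)"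
  have in_duals: "shift e j \<in> duals" if j: "j \<in> duals" for e j
  proof -
    have "int n dvd (\<Sum>w\<in>verts G. shift e j w - j w)"
    proof -
      have fin: "finite (verts G)" by simp
      have "(\<Sum>w\<in>verts G. shift e j w - j w) = (\<Sum>w\<in>{u,v}. shift e j w - j w)"
        using uv by (intro sum.mono_neutral_right) (auto simp: shift_def)
      also have "\<dots> = ((j u + e) mod int n - (j u + e)) + ((j v - e) mod int n - (j v - e))"
        using \<open>u \<noteq> v\<close> uv by (simp add: shift_def)
      finally show ?thesis by (metis dvd_add mod_0_imp_dvd mod_diff_left_eq diff_self mod_0)
    qed
    then have "int n dvd (\<Sum>w\<in>verts G. shift e j w)"
      using j by (simp add: sum_subtractf duals_def balanced_def dvd_diff_commute) (metis dvd_add_right_iff diff_add_cancel add.commute)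
    moreover have "shift e j \<in> verts G \<rightarrow>\<^sub>E {0..<int n}"
      using j n_pos by (auto simp: duals_def shift_def PiE_def extensional_def Pi_def)
    moreover have "shift e j s = 0" using j uv sink_in_verts by (auto simp: shift_def duals_def balanced_def)
    ultimately show ?thesis by (simp add: duals_def balanced_def)
  qed
  have inv: "shift (-e) (shift e j) = j" if j: "j \<in> duals" for e j
  proof
    fix w
    have "w \<in> verts G \<Longrightarrow> j w mod int n = j w" using j by (auto simp: duals_def PiE_def Pi_def)
    then show "shift (-e) (shift e j) w = j w"
      using j \<open>u \<noteq> v\<close> by (auto simp: shift_def duals_def PiE_def extensional_def mod_diff_left_eq mod_add_left_eq)
  qed
  have bij: "bij_betw (shift 1) duals duals"
    by (rule bij_betwI[of _ _ _ "shift (-1)"]) (use in_duals inv[of _ 1] inv[of _ "-1"] in auto)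
  have z: "chi j \<eta> * cnj (chi j \<xi>) = zeta n (p j)" for j
    by (simp add: chi_def zeta_diff[symmetric] p_def pairing_def d_def sum_subtractf[symmetric] algebra_simps)
  have "zeta n (p (shift 1 j)) = zeta n (d u - d v) * zeta n (p j)" for j
  proof -
    have "p (shift 1 j) - p j = (\<Sum>w\<in>nonsink. (shift 1 j w - j w) * d w)"
      by (simp add: p_def sum_subtractf[symmetric] algebra_simps)
    also have "\<dots> = (\<Sum>w\<in>{u,v}. (shift 1 j w - j w) * d w)"
      using uv by (intro sum.mono_neutral_right) (auto simp: shift_def)
    also have "\<dots> = ((j u + 1) mod int n - j u) * d u + ((j v - 1) mod int n - j v) * d v"
      using \<open>u \<noteq> v\<close> uv by (simp add: shift_def)
    finally have "p (shift 1 j) - (d u - d v + p j)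
        = ((j u + 1) mod int n - (j u + 1)) * d u + ((j v - 1) mod int n - (j v - 1)) * d v"
      by (simp add: algebra_simps)
    moreover have "int n dvd x mod int n - x" for x by (metis mod_0_imp_dvd mod_diff_left_eq diff_self mod_0)
    ultimately have "int n dvd p (shift 1 j) - (d u - d v + p j)" by simp
    then show ?thesis using zeta_cong[OF n_pos] by (simp add: zeta_add[symmetric])
  qed
  then have "(\<Sum>j\<in>duals. zeta n (p j)) = zeta n (d u - d v) * (\<Sum>j\<in>duals. zeta n (p j))"
    using sum.reindex_bij_betw[OF bij, of "\<lambda>j. zeta n (p j)"] by (simp add: sum_distrib_left)
  then have "(1 - zeta n (d u - d v)) * (\<Sum>j\<in>duals. zeta n (p j)) = 0" by (simp add: algebra_simps)
  then show ?thesis using uv zeta_eq_1_iff[OF n_pos] by (auto simp: z)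
qed

lemma parseval:
  fixes a :: "('a \<Rightarrow> nat) \<Rightarrow> real"
  shows "(\<Sum>j\<in>duals. (cmod (\<Sum>\<eta>\<in>recurrent. of_real (a \<eta>) * chi j \<eta>))\<^sup>2)
       = real (card duals) * (\<Sum>\<eta>\<in>recurrent. (a \<eta>)\<^sup>2)"
proof -
  have "complex_of_real (\<Sum>j\<in>duals. (cmod (\<Sum>\<eta>\<in>recurrent. of_real (a \<eta>) * chi j \<eta>))\<^sup>2)
      = (\<Sum>j\<in>duals. \<Sum>\<eta>\<in>recurrent. \<Sum>\<xi>\<in>recurrent. of_real (a \<eta> * a \<xi>) * (chi j \<eta> * cnj (chi j \<xi>)))"
    unfolding of_real_sum complex_norm_square cnj_sum sum_product
    by (intro sum.cong refl) (simp add: ac_simps)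
  also have "\<dots> = (\<Sum>\<eta>\<in>recurrent. \<Sum>\<xi>\<in>recurrent. \<Sum>j\<in>duals. of_real (a \<eta> * a \<xi>) * (chi j \<eta> * cnj (chi j \<xi>)))"
    by (subst sum.swap, intro sum.cong refl, subst sum.swap) simp
  also have "\<dots> = (\<Sum>\<eta>\<in>recurrent. \<Sum>\<xi>\<in>recurrent. if \<eta> = \<xi> then of_real ((a \<eta>)\<^sup>2) * of_nat (card duals) else 0)"
    by (intro sum.cong refl)
      (auto simp: sum_distrib_left[symmetric] sum_duals_orthogonal power2_eq_square)
  also have "\<dots> = complex_of_real (real (card duals) * (\<Sum>\<eta>\<in>recurrent. (a \<eta>)\<^sup>2))"
    by (simp add: sum.delta finite_recurrent sum_distrib_left mult.commute)
  finally show ?thesis unfolding of_real_eq_iff .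
qed

text \<open>Parseval for the constant function 1: only the trivial character contributes, which
  gives \<open>card duals * card recurrent = (card recurrent)^2\<close>. Neither set has to be
  counted.\<close>

lemma card_recurrent_eq_duals: "card recurrent = card duals"
proof -
  have "(\<Sum>j\<in>duals. (cmod (\<Sum>\<eta>\<in>recurrent. of_real 1 * chi j \<eta>))\<^sup>2)
      = (\<Sum>j\<in>{trivial_dual}. (cmod (\<Sum>\<eta>\<in>recurrent. of_real 1 * chi j \<eta>))\<^sup>2)"
  proof (rule sum.mono_neutral_right)
    show "\<forall>j\<in>duals - {trivial_dual}. (cmod (\<Sum>\<eta>\<in>recurrent. of_real 1 * chi j \<eta>))\<^sup>2 = 0"
    proof
      fix j assume j: "j \<in> duals - {trivial_dual}"
      then obtain v where "v \<in> verts G" "\<not> int n dvd j v" using nontrivial_dual by blast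
      then show "(cmod (\<Sum>\<eta>\<in>recurrent. of_real 1 * chi j \<eta>))\<^sup>2 = 0"
        using sum_chi_recurrent[of j v] j by (simp add: duals_def)
    qed
  qed (use finite_duals trivial_dual_in in auto)
  also have "\<dots> = (real (card recurrent))\<^sup>2" by (simp add: chi_trivial norm_of_nat)
  finally have "real (card duals) * real (card recurrent) = (real (card recurrent))\<^sup>2"
    using parseval[of "\<lambda>_. 1"] by simp
  moreover have "card recurrent > 0" using recurrent_nonempty finite_recurrent by (simp add: card_gt_0_iff)
  ultimately show ?thesis by (simp add: power2_eq_square)
qed

lemma pmf_uniform: "\<eta> \<in> recurrent \<Longrightarrow> pmf uniform_dist \<eta> = 1 / real (card recurrent)"
  by (simp add: uniform_dist_def pmf_of_set[OF recurrent_nonempty finite_recurrent])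

lemma tv_upper_bound:
  assumes "\<sigma> \<in> recurrent"
  shows "4 * (tv_dist (chain_dist \<sigma> t) uniform_dist)\<^sup>2
       \<le> (\<Sum>j\<in>duals - {trivial_dual}. ((cmod (eigenvalue j))\<^sup>2) ^ t)"
proof -
  let ?P = "chain_dist \<sigma> t"
  define a where "a = (\<lambda>\<eta>. pmf ?P \<eta> - pmf uniform_dist \<eta>)"
  have r: "card recurrent > 0" using recurrent_nonempty finite_recurrent by (simp add: card_gt_0_iff)
  \<comment> \<open>Subtracting the uniform distribution removes the trivial Fourier coefficient and
    changes no other.\<close>
  have hat: "(\<Sum>\<eta>\<in>recurrent. of_real (a \<eta>) * chi j \<eta>)
      = (if j = trivial_dual then 0 else eigenvalue j ^ t * chi j \<sigma>)" if j: "j \<in> duals" for j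
  proof -
    have b: "balanced j" using j by (simp add: duals_def)
    have e: "(\<Sum>\<eta>\<in>recurrent. of_real (a \<eta>) * chi j \<eta>)
       = (\<Sum>\<eta>\<in>recurrent. of_real (pmf ?P \<eta>) * chi j \<eta>) - (\<Sum>\<eta>\<in>recurrent. chi j \<eta>) / of_nat (card recurrent)"
      by (simp add: a_def pmf_uniform left_diff_distrib sum_subtractf sum_divide_distrib)
    show ?thesis
    proof (cases "j = trivial_dual")
      case True
      have "(\<Sum>\<eta>\<in>recurrent. pmf ?P \<eta>) = 1"
        using set_chain_dist[OF assms] finite_recurrent by (rule sum_pmf_eq_1[rotated])
      then have "(\<Sum>\<eta>\<in>recurrent. complex_of_real (pmf ?P \<eta>)) = 1"
        by (metis of_real_1 of_real_sum)
      then show ?thesis using True e r by (simp add: chi_trivial)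
    next
      case False
      then obtain v where "v \<in> verts G" "\<not> int n dvd j v" using nontrivial_dual j by blast
      then have "(\<Sum>\<eta>\<in>recurrent. chi j \<eta>) = 0" by (rule sum_chi_recurrent[OF b])
      then show ?thesis using False e sum_pmf_chi[OF b assms, of t] by simp
    qed
  qed
  have "4 * (tv_dist ?P uniform_dist)\<^sup>2 = (\<Sum>\<eta>\<in>recurrent. \<bar>a \<eta>\<bar> * 1)\<^sup>2"
    by (simp add: tv_dist_def a_def power_mult_distrib power2_eq_square)
  also have "\<dots> \<le> (\<Sum>\<eta>\<in>recurrent. \<bar>a \<eta>\<bar>\<^sup>2) * (\<Sum>\<eta>\<in>recurrent. 1\<^sup>2)"
    by (rule Cauchy_Schwarz_ineq_sum)
  \<comment> \<open>The factor from Cauchy--Schwarz is the one appearing in Parseval's identity, so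
    the size of the group drops out.\<close>
  also have "\<dots> = real (card duals) * (\<Sum>\<eta>\<in>recurrent. (a \<eta>)\<^sup>2)"
    by (simp add: card_recurrent_eq_duals mult.commute)
  also have "\<dots> = (\<Sum>j\<in>duals. (cmod (\<Sum>\<eta>\<in>recurrent. of_real (a \<eta>) * chi j \<eta>))\<^sup>2)"
    by (rule parseval[symmetric])
  also have "\<dots> = (\<Sum>j\<in>duals. if j = trivial_dual then 0 else ((cmod (eigenvalue j))\<^sup>2) ^ t)"
    by (intro sum.cong refl) (simp add: hat norm_mult norm_power power_mult[symmetric] mult.commute)
  also have "\<dots> = (\<Sum>j\<in>duals - {trivial_dual}. ((cmod (eigenvalue j))\<^sup>2) ^ t)"
    by (rule sum.mono_neutral_cong_right) (use finite_duals in auto)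
  finally show ?thesis .
qed

end

section \<open>The sum of the eigenvalue powers\<close>

definition gap :: "nat \<Rightarrow> int \<Rightarrow> real" where
  "gap n x = 1 - cos (2 * pi * of_int x / of_nat n)"

lemma gap_eq_Re: "gap n x = 1 - Re (zeta n x)"
  by (simp add: gap_def zeta_def)

lemma gap_nonneg [simp]: "0 \<le> gap n x"
  by (simp add: gap_def)

lemma gap_0 [simp]: "gap n 0 = 0"
  by (simp add: gap_def)

lemma gap_uminus: "gap n (- x) = gap n x"
  by (simp add: gap_def)

lemma gap_commute: "gap n (x - y) = gap n (y - x)"
  using gap_uminus[of n "x - y"] by simp

lemma gap_mod [simp]: "n > 0 \<Longrightarrow> gap n (x mod int n) = gap n x"
  by (simp add: gap_eq_Re)

lemma gap_reflect: "n > 0 \<Longrightarrow> gap n (int n - x) = gap n x"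
  using gap_uminus[of n x] gap_mod[of n "int n - x"] gap_mod[of n "- x"] by simp

lemma gap_mono:
  assumes "0 \<le> x" "x \<le> y" "2 * y \<le> int n"
  shows "gap n x \<le> gap n y"
proof (cases "n = 0")
  case False
  have "2 * real_of_int y \<le> real n" using assms(3) by linarith
  then have "2 * pi * real_of_int y \<le> pi * real n"
    using mult_left_mono[of "2 * real_of_int y" "real n" pi] by simp
  then show ?thesis using assms False unfolding gap_def
    by (intro diff_left_mono cos_monotone_0_pi_le) (auto simp: field_simps)
qed (simp add: gap_def)

lemma gap_eq_sin: "gap n x = 2 * (sin (pi * of_int x / of_nat n))\<^sup>2"
  using cos_double_sin[of "pi * of_int x / of_nat n"] by (simp add: gap_def field_simps)

text \<open>The increments are \<open>sin\<^sup>2((a+1)x) - sin\<^sup>2(ax) = sin((2a+1)x) sin x\<close>, which is at least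
  \<open>sin\<^sup>2 x\<close> as long as \<open>(2a+1)x\<close> lies between \<open>x\<close> and \<open>\<pi> - x\<close>.\<close>
lemma gap_ge_linear:
  assumes "2 * a \<le> n"
  shows "real a * gap n 1 \<le> gap n (int a)"
  using assms
proof (induction a)
  case (Suc a)
  define x where "x = pi / real n"
  have n: "n > 0" using Suc by simp
  have nx: "real n * x = pi" using n by (simp add: x_def)
  have x0: "0 \<le> x" by (simp add: x_def)
  have le: "(2 * real a + 2) * x \<le> pi"
    using Suc.prems x0 nx by (metis mult_right_mono of_nat_le_iff of_nat_Suc of_nat_mult of_nat_numeral distrib_left mult.right_neutral add.commute)
  have "0 \<le> 2 * real a * x" using x0 by simp
  then have small: "x \<le> pi / 2" using le by (simp add: algebra_simps)
  have low: "- (pi / 2) \<le> x" using x0 pi_gt_zero by linarith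
  have "sin x \<le> sin ((2 * real a + 1) * x)"
  proof (cases "(2 * real a + 1) * x \<le> pi / 2")
    case True
    then show ?thesis using x0 \<open>0 \<le> 2 * real a * x\<close> low by (intro sin_monotone_2pi_le) (auto simp: algebra_simps)
  next
    case False
    have "sin x \<le> sin (pi - (2 * real a + 1) * x)"
      using False x0 le low by (intro sin_monotone_2pi_le) (auto simp: algebra_simps)
    then show ?thesis by simp
  qed
  moreover have "0 \<le> sin x" using x0 small by (intro sin_ge_zero) auto
  ultimately have "sin x * sin x \<le> sin ((2 * real a + 1) * x) * sin x" by (rule mult_right_mono)
  also have "\<dots> = (sin ((real a + 1) * x))\<^sup>2 - (sin (real a * x))\<^sup>2"
  proof -
    have e1: "(2 * real a + 1) * x = (real a + 1) * x + real a * x" and e2: "x = (real a + 1) * x - real a * x"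
      by (simp_all add: algebra_simps)
    have "sin ((2 * real a + 1) * x) * sin x = (cos (2 * (real a * x)) - cos (2 * ((real a + 1) * x))) / 2"
      unfolding sin_times_sin by (simp add: algebra_simps)
    then show ?thesis unfolding cos_double_sin by (simp add: field_simps)
  qed
  finally have "gap n 1 \<le> gap n (int (Suc a)) - gap n (int a)"
    unfolding gap_eq_sin by (simp add: x_def power2_eq_square algebra_simps)
  then show ?case using Suc by (simp add: algebra_simps)
qed simp

lemma sin_ge_cubic: "0 \<le> x \<Longrightarrow> x - x ^ 3 / 6 \<le> sin (x::real)"
proof -
  assume "0 \<le> x"
  define h where "h = (\<lambda>x::real. sin x - x + x ^ 3 / 6)"
  have "h 0 \<le> h x"
  proof (rule DERIV_nonneg_imp_nondecreasing[OF \<open>0 \<le> x\<close>])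
    fix y :: real
    have "(h has_real_derivative cos y - 1 + y\<^sup>2 / 2) (at y)"
      unfolding h_def by (auto intro!: derivative_eq_intros simp: power2_eq_square)
    moreover have "0 \<le> cos y - 1 + y\<^sup>2 / 2"
    proof -
      have "(sin (y / 2))\<^sup>2 \<le> (y / 2)\<^sup>2" using abs_sin_x_le_abs_x[of "y / 2"] by (simp add: abs_le_square_iff[symmetric])
      then show ?thesis using cos_double_sin[of "y / 2"] by (simp add: power_divide)
    qed
    ultimately show "\<exists>d. (h has_real_derivative d) (at y) \<and> 0 \<le> d" by blast
  qed
  then show ?thesis by (simp add: h_def)
qed

text \<open>The cubic lower bound for the sine is squared and its nonnegative top-order term
  dropped; \<open>x\<^sup>2 \<le> 6\<close> keeps the cubic nonnegative, as squaring
  requires.\<close>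

lemma sin_squared_ge:
  fixes x :: real
  assumes "0 \<le> x" "x\<^sup>2 \<le> 6"
  shows "x\<^sup>2 * (1 - x\<^sup>2 / 3) \<le> (sin x)\<^sup>2"
proof -
  have "(1 - x\<^sup>2 / 6)\<^sup>2 = 1 - x\<^sup>2 / 3 + (x\<^sup>2 / 6)\<^sup>2"
    by (simp add: power2_eq_square algebra_simps)
  then have "x\<^sup>2 * (1 - x\<^sup>2 / 3) \<le> x\<^sup>2 * (1 - x\<^sup>2 / 6)\<^sup>2"
    by (intro mult_left_mono) auto
  also have "\<dots> = (x - x ^ 3 / 6)\<^sup>2" by (simp add: power2_eq_square power3_eq_cube algebra_simps)
  also have "\<dots> \<le> (sin x)\<^sup>2"
  proof (rule power_mono[OF sin_ge_cubic[OF assms(1)]])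
    have "0 \<le> x * (1 - x\<^sup>2 / 6)" using assms by (intro mult_nonneg_nonneg) auto
    then show "0 \<le> x - x ^ 3 / 6" by (simp add: power2_eq_square power3_eq_cube algebra_simps)
  qed
  finally show ?thesis .
qed

text \<open>Expanding the product with the conjugate turns the loss of modulus into a sum of
  nonnegative contributions of pairs of vertices.\<close>

lemma norm_sum_zeta_squared:
  "(cmod (\<Sum>v\<in>V. zeta n (j v)))\<^sup>2 = (\<Sum>u\<in>V. \<Sum>v\<in>V. 1 - gap n (j u - j v))"
proof -
  have "(cmod (\<Sum>v\<in>V. zeta n (j v)))\<^sup>2 = Re ((\<Sum>v\<in>V. zeta n (j v)) * cnj (\<Sum>v\<in>V. zeta n (j v)))"
    by (metis Re_complex_of_real complex_norm_square)
  also have "\<dots> = (\<Sum>u\<in>V. \<Sum>v\<in>V. Re (zeta n (j u - j v)))"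
    by (simp only: cnj_sum sum_product Re_sum zeta_diff)
  finally show ?thesis by (simp add: gap_eq_Re)
qed

section \<open>Pair sums for spread and for concentrated exponents\<close>

lemma gap_ge_gap_2:
  assumes "x mod int n \<notin> {0, 1, int n - 1}" "n > 0"
  shows "gap n 2 \<le> gap n x"
proof -
  define y where "y = x mod int n"
  have y: "0 \<le> y" "y < int n" using assms(2) by (simp_all add: y_def)
  then have y2: "2 \<le> y" "y \<le> int n - 2" using assms by (auto simp: y_def[symmetric])
  have "gap n 2 \<le> gap n y"
  proof (cases "2 * y \<le> int n")
    case True
    then show ?thesis using y2 by (intro gap_mono) auto
  next
    case False
    then have "gap n 2 \<le> gap n (int n - y)" using y2 by (intro gap_mono) auto
    then show ?thesis using gap_reflect[OF assms(2)] by simp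
  qed
  then show ?thesis using assms(2) by (simp add: y_def)
qed

text \<open>For fixed \<open>u\<close>, only three residues lie within distance 1 of
  \<open>j u\<close>, and together they are taken at most 3m times, hence by at most half of the
  vertices. Every other vertex contributes at least \<open>gap n 2\<close>.\<close>

lemma spread_gap_sum:
  assumes "finite V" "card V = n" "n > 0" and range: "\<And>v. v \<in> V \<Longrightarrow> j v \<in> {0..<int n}"
    and m: "\<And>b. card {v \<in> V. j v = b} \<le> m" and "6 * m \<le> n"
  shows "(real n)\<^sup>2 * (gap n 2 / 2) \<le> (\<Sum>u\<in>V. \<Sum>v\<in>V. gap n (j u - j v))"
proof -
  have "real n * (gap n 2 / 2) \<le> (\<Sum>v\<in>V. gap n (j u - j v))" if u: "u \<in> V" for u
  proof -
    define B where "B = {v \<in> V. (j u - j v) mod int n \<in> {0, 1, int n - 1}}"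
    have "B \<subseteq> {v \<in> V. j v = j u} \<union> {v \<in> V. j v = (j u - 1) mod int n} \<union> {v \<in> V. j v = (j u + 1) mod int n}"
    proof
      fix v assume v: "v \<in> B"
      then have jv: "j v = (j u - (j u - j v) mod int n) mod int n"
        using range[of v] by (simp add: B_def mod_diff_right_eq)
      have ju: "j u mod int n = j u" using range[OF u] by simp
      have "(j u - (int n - 1)) mod int n = (j u + 1) mod int n"
        by (metis add_diff_eq diff_add_eq diff_diff_eq2 minus_mod_self2)
      then show "v \<in> {v \<in> V. j v = j u} \<union> {v \<in> V. j v = (j u - 1) mod int n} \<union> {v \<in> V. j v = (j u + 1) mod int n}"
        using v jv ju by (auto simp: B_def)
    qed
    then have "card B \<le> card ({v \<in> V. j v = j u} \<union> {v \<in> V. j v = (j u - 1) mod int n} \<union> {v \<in> V. j v = (j u + 1) mod int n})"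
      using assms(1) by (intro card_mono) auto
    also have "\<dots> \<le> m + m + m"
      by (intro order_trans[OF card_Un_le] add_mono m)
    finally have "2 * card B \<le> n" using \<open>6 * m \<le> n\<close> by simp
    moreover have "B \<subseteq> V" by (auto simp: B_def)
    ultimately have "n \<le> 2 * card (V - B)"
      using assms by (simp add: card_Diff_subset finite_subset)
    then have "real n * (gap n 2 / 2) \<le> (2 * real (card (V - B))) * (gap n 2 / 2)"
      by (intro mult_right_mono) auto
    also have "\<dots> = (\<Sum>v\<in>V - B. gap n 2)" by simp
    also have "\<dots> \<le> (\<Sum>v\<in>V - B. gap n (j u - j v))"
      using \<open>n > 0\<close> by (intro sum_mono gap_ge_gap_2) (auto simp: B_def)
    also have "\<dots> \<le> (\<Sum>v\<in>V. gap n (j u - j v))"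
      using assms(1) by (intro sum_mono2) auto
    finally show ?thesis .
  qed
  then have "(\<Sum>u\<in>V. real n * (gap n 2 / 2)) \<le> (\<Sum>u\<in>V. \<Sum>v\<in>V. gap n (j u - j v))"
    by (rule sum_mono)
  then show ?thesis using assms by (simp add: power2_eq_square mult.assoc)
qed

text \<open>Only pairs with exactly one entry in \<open>S\<close> are kept; the factor 2 comes from
  the two orders of such a pair.\<close>

lemma mode_gap_sum:
  fixes j :: "'a \<Rightarrow> int" and b :: int
  assumes "finite V"
  defines "S \<equiv> {v \<in> V. j v \<noteq> b}"
  shows "2 * real (card V - card S) * (\<Sum>v\<in>S. gap n (j v - b)) \<le> (\<Sum>u\<in>V. \<Sum>v\<in>V. gap n (j u - j v))"
proof -
  define M where "M = {v \<in> V. j v = b}"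
  have V: "V = M \<union> S" "M \<inter> S = {}" "finite M" "finite S" using assms by (auto simp: M_def S_def)
  have cM: "card V - card S = card M" using V by (metis add_diff_cancel_right' card_Un_disjoint)
  have inner: "(\<Sum>v\<in>V. f v) = (\<Sum>v\<in>M. f v) + (\<Sum>v\<in>S. f v)" for f :: "_ \<Rightarrow> real"
    using V by (metis sum.union_disjoint)
  have "(\<Sum>u\<in>M. \<Sum>v\<in>S. gap n (j u - j v)) = real (card M) * (\<Sum>v\<in>S. gap n (j v - b))"
  proof -
    have "(\<Sum>u\<in>M. \<Sum>v\<in>S. gap n (j u - j v)) = (\<Sum>u\<in>M. \<Sum>v\<in>S. gap n (j v - b))"
      by (intro sum.cong refl) (auto simp: M_def gap_commute)
    then show ?thesis by simp
  qed
  moreover have "(\<Sum>u\<in>S. \<Sum>v\<in>M. gap n (j u - j v)) = real (card M) * (\<Sum>v\<in>S. gap n (j v - b))"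
  proof -
    have "(\<Sum>u\<in>S. \<Sum>v\<in>M. gap n (j u - j v)) = (\<Sum>u\<in>S. \<Sum>v\<in>M. gap n (j u - b))"
      by (intro sum.cong refl) (auto simp: M_def)
    then show ?thesis by (simp add: sum_distrib_left)
  qed
  moreover have "0 \<le> (\<Sum>u\<in>M. \<Sum>v\<in>M. gap n (j u - j v))" "0 \<le> (\<Sum>u\<in>S. \<Sum>v\<in>S. gap n (j u - j v))"
    by (intro sum_nonneg gap_nonneg)+
  moreover have "(\<Sum>u\<in>V. \<Sum>v\<in>V. gap n (j u - j v))
     = ((\<Sum>u\<in>M. \<Sum>v\<in>M. gap n (j u - j v)) + (\<Sum>u\<in>M. \<Sum>v\<in>S. gap n (j u - j v)))
     + ((\<Sum>u\<in>S. \<Sum>v\<in>M. gap n (j u - j v)) + (\<Sum>u\<in>S. \<Sum>v\<in>S. gap n (j u - j v)))"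
    by (simp only: inner sum.distrib)
  ultimately show ?thesis unfolding cM by simp
qed

text \<open>Here \<open>w k\<close> is the total weight of a coordinate differing from the mode of \<open>j\<close> when there are
  \<open>k\<close> such coordinates. Since \<open>j s = 0\<close>, the mode can be recovered from the shifted coordinates.\<close>
lemma sum_by_mode:
  fixes n t :: nat and V :: "'a set"
  assumes fin: "finite V" and card: "card V = n" and n: "n > 0" and s: "s \<in> V"
    and D: "D \<subseteq> V \<rightarrow>\<^sub>E {0..<int n}" "\<And>j. j \<in> D \<Longrightarrow> j s = 0" and triv: "(\<lambda>v\<in>V. 0) \<notin> D"
  defines "w \<equiv> \<lambda>k. \<Sum>a\<in>{1..<int n}. exp (- (2 * real t * real (n - k) / (real n)\<^sup>2 * gap n a))"
  shows "(\<Sum>j\<in>D. ((cmod (\<Sum>v\<in>V. zeta n (j v)) / real n)\<^sup>2) ^ t)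
       \<le> real n ^ n * exp (- (real t * gap n 2 / 2))
         + (\<Sum>k | 1 \<le> k \<and> k \<le> n \<and> n < 6 * (n - k). real (n choose k) * w k ^ k)"
proof -
  define L where "L = (\<lambda>j. ((cmod (\<Sum>v\<in>V. zeta n (j v)) / real n)\<^sup>2) ^ t)"
  define E where "E = (\<lambda>j. (\<Sum>u\<in>V. \<Sum>v\<in>V. gap n (j u - j v)) / (real n)\<^sup>2)"
  \<comment> \<open>\<open>E j\<close> is the loss 1 - |eigenvalue|^2, and 1 - x is at most
    exp(-x).\<close>
  have L: "L j \<le> exp (- (real t * E j))" for j
  proof -
    have "(\<Sum>u\<in>V. \<Sum>v\<in>V. 1 - gap n (j u - j v)) = (real n)\<^sup>2 - (\<Sum>u\<in>V. \<Sum>v\<in>V. gap n (j u - j v))"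
      using card by (simp add: sum_subtractf power2_eq_square)
    then have "(cmod (\<Sum>v\<in>V. zeta n (j v)) / real n)\<^sup>2 = 1 - E j"
      unfolding power_divide norm_sum_zeta_squared E_def using n by (simp add: diff_divide_distrib)
    also have "\<dots> \<le> exp (- E j)" using exp_ge_add_one_self[of "- E j"] by simp
    finally have "L j \<le> exp (- E j) ^ t"
      unfolding L_def by (intro power_mono) auto
    then show ?thesis by (simp add: exp_of_nat_mult[symmetric])
  qed
  have finD: "finite D" using D(1) fin by (rule_tac finite_subset[OF D(1)]) (auto intro!: finite_PiE)
  have rng: "0 \<le> j v" "j v < int n" if "j \<in> D" "v \<in> V" for j v
    using PiE_mem[of j V "\<lambda>_. {0..<int n}" v] D(1) that by auto
  define cnt where "cnt = (\<lambda>j b. card {v \<in> V. j v = (b::int)})"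
  have "\<exists>b. \<forall>b'. cnt j b' \<le> cnt j b" for j
  proof -
    have "range (cnt j) \<subseteq> {..card V}" using fin by (auto simp: cnt_def intro: card_mono)
    then have "finite (range (cnt j))" by (rule finite_subset) simp
    then have "Max (range (cnt j)) \<in> range (cnt j)" "\<And>b. cnt j b \<le> Max (range (cnt j))"
      by (auto intro: Max_in)
    then show ?thesis by (metis imageE)
  qed
  then obtain mode where mode: "\<And>j b. cnt j b \<le> cnt j (mode j)" by metis
  define S where "S = (\<lambda>j. {v \<in> V. j v \<noteq> mode j})"
  have cS: "card (S j) + cnt j (mode j) = n" for j
  proof -
    have "S j \<union> {v \<in> V. j v = mode j} = V" "S j \<inter> {v \<in> V. j v = mode j} = {}" by (auto simp: S_def)
    then show ?thesis unfolding cnt_def using fin card by (metis card_Un_disjoint finite_Un)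
  qed
  \<comment> \<open>The threshold n/6 is the one required by \<open>spread_gap_sum\<close>. On
    \<open>D2\<close> more than n/6 vertices sit at the mode, which keeps the factor n - k in the
    exponent of the weights large.\<close>
  define D1 where "D1 = {j \<in> D. 6 * cnt j (mode j) \<le> n}"
  define D2 where "D2 = {j \<in> D. n < 6 * cnt j (mode j)}"
  have split: "D = D1 \<union> D2" "D1 \<inter> D2 = {}" by (auto simp: D1_def D2_def)
  have "(\<Sum>j\<in>D1. L j) \<le> (\<Sum>j\<in>D1. exp (- (real t * gap n 2 / 2)))"
  proof (rule sum_mono)
    fix j assume j: "j \<in> D1"
    have "(real n)\<^sup>2 * (gap n 2 / 2) \<le> (\<Sum>u\<in>V. \<Sum>v\<in>V. gap n (j u - j v))"
      by (rule spread_gap_sum[OF fin card n, of _ "cnt j (mode j)"])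
        (use j rng mode[of j] in \<open>auto simp: D1_def cnt_def\<close>)
    then have "gap n 2 / 2 \<le> E j" using n by (simp add: E_def field_simps)
    then have "real t * (gap n 2 / 2) \<le> real t * E j" by (rule mult_left_mono) simp
    then show "L j \<le> exp (- (real t * gap n 2 / 2))"
      by (intro order_trans[OF L]) simp
  qed
  also have "\<dots> \<le> real n ^ n * exp (- (real t * gap n 2 / 2))"
  proof -
    have "card D1 \<le> card (V \<rightarrow>\<^sub>E {0..<int n})"
      using D fin by (intro card_mono finite_PiE) (auto simp: D1_def)
    then have "card D1 \<le> n ^ n" using fin card by (simp add: card_PiE)
    then have "real (card D1) \<le> real n ^ n" by (metis of_nat_le_iff of_nat_power)
    then show ?thesis by (simp add: mult_right_mono)
  qed
  finally have part1: "(\<Sum>j\<in>D1. L j) \<le> real n ^ n * exp (- (real t * gap n 2 / 2))" .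
  define K where "K = {k. 1 \<le> k \<and> k \<le> n \<and> n < 6 * (n - k)}"
  define Y where "Y = {T. T \<subseteq> V \<and> card T \<in> K}"
  define A where "A = (\<lambda>T :: 'a set. T \<rightarrow>\<^sub>E {1..<int n})"
  define wt where "wt = (\<lambda>k a. exp (- (2 * real t * real (n - k) / (real n)\<^sup>2 * gap n a)))"
  define \<Phi> where "\<Phi> = (\<lambda>j. (S j, \<lambda>v\<in>S j. (j v - mode j) mod int n))"
  have finY: "finite Y" using fin by (simp add: Y_def)
  have Y_fin: "finite T" if "T \<in> Y" for T using that fin by (auto simp: Y_def intro: finite_subset)
  have "inj_on \<Phi> D2"
  proof (rule inj_onI)
    fix i j assume ij: "i \<in> D2" "j \<in> D2" and eq: "\<Phi> i = \<Phi> j"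
    \<comment> \<open>At \<open>s\<close> the encoded value is minus the mode modulo n, so
      subtracting it cancels the mode in every other coordinate.\<close>
    have rec: "i v = ((if v \<in> S i then snd (\<Phi> i) v else 0) - (if s \<in> S i then snd (\<Phi> i) s else 0)) mod int n"
      if "i \<in> D" "v \<in> V" for i v
    proof -
      have a: "(if v \<in> S i then snd (\<Phi> i) v else 0) = (i v - mode i) mod int n" if "v \<in> V" for v
        using that by (auto simp: \<Phi>_def S_def)
      have "i v = (i v - i s) mod int n" using that D by (force simp: PiE_def Pi_def)
      then show ?thesis unfolding a[OF that(2)] a[OF s] by (simp add: mod_diff_eq)
    qed
    have S: "S i = S j" using arg_cong[OF eq, of fst] by (simp only: \<Phi>_def fst_conv)
    show "i = j"
    proof
      fix v
      show "i v = j v"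
      proof (cases "v \<in> V")
        case True
        have D: "i \<in> D" "j \<in> D" using ij by (auto simp: D2_def)
        show ?thesis by (rule trans[OF rec[OF D(1) True, unfolded S eq] rec[OF D(2) True, symmetric]])
      next
        case False
        have D': "i \<in> V \<rightarrow>\<^sub>E {0..<int n}" "j \<in> V \<rightarrow>\<^sub>E {0..<int n}"
          using ij D(1) unfolding D2_def by blast+
        show ?thesis by (rule trans[OF PiE_arb[OF D'(1) False] PiE_arb[OF D'(2) False, symmetric]])
      qed
    qed
  qed
  moreover have "\<Phi> ` D2 \<subseteq> Sigma Y A"
  proof
    fix p assume "p \<in> \<Phi> ` D2"
    then obtain j where j: "j \<in> D2" "p = \<Phi> j" by blast
    have r: "j v \<in> {0..<int n}" if "v \<in> V" for v using rng[of j v] j that by (simp add: D2_def)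
    \<comment> \<open>With no vertex off the mode, \<open>j\<close> is constant, and
      \<open>j s = 0\<close> makes it the excluded trivial exponent. Hence k starts at 1.\<close>
    have "S j \<noteq> {}"
    proof
      assume "S j = {}"
      then have "\<forall>v\<in>V. j v = 0" using D(2)[of j] j s by (auto simp: S_def D2_def)
      moreover have "j \<in> extensional V" using j D(1) unfolding D2_def PiE_def by blast
      ultimately have "j = (\<lambda>v\<in>V. 0)" by (auto intro: extensionalityI)
      with j triv show False by (auto simp: D2_def)
    qed
    moreover have "finite (S j)" using fin by (simp add: S_def)
    ultimately have "1 \<le> card (S j)" by (simp add: Suc_le_eq card_gt_0_iff)
    moreover have "n < 6 * (n - card (S j))" using j cS[of j] by (auto simp: D2_def)
    ultimately have "S j \<in> Y" using cS[of j] by (auto simp: Y_def K_def S_def)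
    moreover have "(j v - mode j) mod int n \<in> {1..<int n}" if v: "v \<in> S j" for v
    proof -
      have "S j \<noteq> V" using \<open>n < 6 * (n - card (S j))\<close> card by auto
      then obtain u where "u \<in> V" "j u = mode j" by (auto simp: S_def)
      then have "mode j \<in> {0..<int n}" using r by metis
      moreover have "j v \<in> {0..<int n}" "j v \<noteq> mode j" using r v by (auto simp: S_def)
      ultimately have "\<not> int n dvd j v - mode j"
        by (metis atLeastLessThan_iff mod_eq_dvd_iff mod_pos_pos_trivial)
      then have "(j v - mode j) mod int n \<noteq> 0" by (simp add: dvd_eq_mod_eq_0)
      moreover have "0 \<le> (j v - mode j) mod int n" "(j v - mode j) mod int n < int n" using n by simp_all
      ultimately show ?thesis by simp
    qed
    ultimately show "p \<in> Sigma Y A" using j by (auto simp: \<Phi>_def A_def)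
  qed
  moreover have "L j \<le> (\<Prod>v\<in>fst (\<Phi> j). wt (card (fst (\<Phi> j))) (snd (\<Phi> j) v))" if "j \<in> D2" for j
  proof -
    have "2 * real (n - card (S j)) * (\<Sum>v\<in>S j. gap n (j v - mode j)) / (real n)\<^sup>2 \<le> E j"
      using mode_gap_sum[OF fin, of j "mode j" n] unfolding E_def S_def card by (rule divide_right_mono) simp
    then have "real t * (2 * real (n - card (S j)) * (\<Sum>v\<in>S j. gap n (j v - mode j)) / (real n)\<^sup>2) \<le> real t * E j"
      by (rule mult_left_mono) simp
    then have "L j \<le> exp (- (real t * (2 * real (n - card (S j)) * (\<Sum>v\<in>S j. gap n (j v - mode j)) / (real n)\<^sup>2)))"
      by (intro order_trans[OF L]) simp
    also have "\<dots> = exp (\<Sum>v\<in>S j. - (2 * real t * real (n - card (S j)) / (real n)\<^sup>2 * gap n (j v - mode j)))"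
      by (simp add: sum_negf sum_distrib_left sum_divide_distrib field_simps)
    also have "\<dots> = (\<Prod>v\<in>S j. wt (card (S j)) (j v - mode j))"
      using fin by (simp add: exp_sum S_def wt_def)
    also have "\<dots> = (\<Prod>v\<in>fst (\<Phi> j). wt (card (fst (\<Phi> j))) (snd (\<Phi> j) v))"
      using n by (simp add: \<Phi>_def wt_def)
    finally show ?thesis .
  qed
  ultimately have "(\<Sum>j\<in>D2. L j) \<le> (\<Sum>p\<in>Sigma Y A. \<Prod>v\<in>fst p. wt (card (fst p)) (snd p v))"
  proof -
    assume inj: "inj_on \<Phi> D2" and im: "\<Phi> ` D2 \<subseteq> Sigma Y A"
      and le: "\<And>j. j \<in> D2 \<Longrightarrow> L j \<le> (\<Prod>v\<in>fst (\<Phi> j). wt (card (fst (\<Phi> j))) (snd (\<Phi> j) v))"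
    have "(\<Sum>j\<in>D2. L j) \<le> (\<Sum>j\<in>D2. \<Prod>v\<in>fst (\<Phi> j). wt (card (fst (\<Phi> j))) (snd (\<Phi> j) v))"
      by (rule sum_mono[OF le])
    also have "\<dots> = (\<Sum>p\<in>\<Phi> ` D2. \<Prod>v\<in>fst p. wt (card (fst p)) (snd p v))"
      by (simp add: sum.reindex[OF inj])
    \<comment> \<open>Allowing all sets \<open>T\<close> of admissible size and all nonzero values
      on them drops the remaining constraints on \<open>j\<close>; the inner sum then factorizes
      over the vertices of \<open>T\<close>.\<close>
    also have "\<dots> \<le> (\<Sum>p\<in>Sigma Y A. \<Prod>v\<in>fst p. wt (card (fst p)) (snd p v))"
      by (rule sum_mono2[OF _ im])
        (auto intro!: finite_SigmaI finY finite_PiE prod_nonneg simp: A_def Y_fin wt_def)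
    finally show ?thesis .
  qed
  also have "\<dots> = (\<Sum>T\<in>Y. \<Sum>a\<in>A T. \<Prod>v\<in>T. wt (card T) (a v))"
    by (subst sum.Sigma) (auto intro!: finY finite_PiE simp: A_def Y_fin case_prod_beta)
  also have "\<dots> = (\<Sum>T\<in>Y. w (card T) ^ card T)"
  proof (rule sum.cong[OF refl])
    fix T assume T: "T \<in> Y"
    show "(\<Sum>a\<in>A T. \<Prod>v\<in>T. wt (card T) (a v)) = w (card T) ^ card T"
      using prod_sum_PiE[OF Y_fin[OF T], of "\<lambda>_. {1..<int n}" "\<lambda>_. wt (card T)"]
      by (simp add: A_def w_def wt_def)
  qed
  also have "\<dots> = (\<Sum>k\<in>K. \<Sum>T\<in>{T \<in> Y. card T = k}. w (card T) ^ card T)"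
    by (rule sum.group[OF finY, symmetric]) (auto simp: K_def Y_def)
  also have "\<dots> = (\<Sum>k\<in>K. real (n choose k) * w k ^ k)"
  proof (rule sum.cong[OF refl])
    fix k assume k: "k \<in> K"
    then have "{T \<in> Y. card T = k} = {T. T \<subseteq> V \<and> card T = k}" by (auto simp: Y_def)
    then have "card {T \<in> Y. card T = k} = n choose k" using n_subsets[OF fin] card by simp
    then show "(\<Sum>T\<in>{T \<in> Y. card T = k}. w (card T) ^ card T) = real (n choose k) * w k ^ k"
      by simp
  qed
  finally have "(\<Sum>j\<in>D2. L j) \<le> (\<Sum>k\<in>K. real (n choose k) * w k ^ k)" .
  then show ?thesis
    using part1 split finD sum.union_disjoint[of D1 D2 L] unfolding L_def K_def by simp
qed

section \<open>Numerical estimates for the upper bound\<close>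

lemma gap_ge_quadratic:
  assumes "a > 0" "(pi * real a)\<^sup>2 \<le> 6 * (real n)\<^sup>2" "n > 0"
  shows "2 * (pi * real a)\<^sup>2 / (real n)\<^sup>2 * (1 - (pi * real a)\<^sup>2 / (3 * (real n)\<^sup>2)) \<le> gap n (int a)"
proof -
  have "(pi * real a / real n)\<^sup>2 \<le> 6" using assms by (simp add: power_divide divide_le_eq)
  moreover have "2 * (pi * real a)\<^sup>2 / (real n)\<^sup>2 * (1 - (pi * real a)\<^sup>2 / (3 * (real n)\<^sup>2))
      = 2 * ((pi * real a / real n)\<^sup>2 * (1 - (pi * real a / real n)\<^sup>2 / 3))"
    by (simp add: power_divide)
  ultimately show ?thesis
    using sin_squared_ge[of "pi * real a / real n"] by (simp add: gap_eq_sin)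
qed

lemma pi_squared_bounds: "49/5 \<le> pi\<^sup>2" "pi\<^sup>2 \<le> 79/8"
proof -
  have "(3.1415::real)\<^sup>2 \<le> pi\<^sup>2" using pi_approx by (intro power_mono) auto
  then show "49/5 \<le> pi\<^sup>2" by (simp add: power2_eq_square)
  have "pi\<^sup>2 \<le> (3.1416::real)\<^sup>2" using pi_approx by (intro power_mono) auto
  then show "pi\<^sup>2 \<le> 79/8" by (simp add: power2_eq_square)
qed

lemma four_le_exp_three_halves: "4 \<le> exp (3 / 2 :: real)"
proof -
  have "(13 / 8 :: real) ^ 3 \<le> exp (1 / 2) ^ 3"
    using exp_lower_Taylor_quadratic[of "1 / 2 :: real"] by (intro power_mono) (auto simp: power2_eq_square)
  also have "\<dots> = exp (3 / 2)" by (simp add: exp_of_nat_mult[symmetric])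
  finally show ?thesis by (simp add: power3_eq_cube)
qed

text \<open>\<open>k ^ k / fact k\<close> is one term of the series of \<open>exp k\<close>, read
  here as a Poisson probability.\<close>

lemma power_self_le_fact: "real k ^ k \<le> exp (real k) * fact k"
proof (cases "k = 0")
  case False
  then have "real k ^ k / fact k * exp (- real k) \<le> 1"
    using pmf_le_1[of "poisson_pmf (real k)" k] by simp
  then show ?thesis by (simp add: exp_minus field_simps)
qed simp

text \<open>The binomial coefficient is at most (en/k)^k, and the exponential is n^(-k) times the
  k-th power of n^(k/n), which is at most ek. All powers of n and k cancel.\<close>

lemma binomial_exp_bound:
  assumes "1 \<le> k" "k \<le> n"
  shows "real (n choose k) * exp (- ((1 - real k / real n) * ln (real n)) * real k) \<le> exp (2 * real k)"
proof -
  have n: "real n > 0" and k: "real k > 0" using assms by auto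
  define y where "y = real n / real k"
  have y: "y > 0" using n k by (simp add: y_def)
  \<comment> \<open>With n = ky, the bound ln y <= y = n/k is exactly what (k/n) ln n <= ln k + 1
    needs.\<close>
  have "ln y \<le> y" using ln_le_minus_one[OF y] by simp
  then have "real k / real n * ln y \<le> 1"
    using mult_left_mono[of "ln y" y "real k / real n"] n k by (simp add: y_def)
  moreover have "real k / real n * ln (real k) \<le> ln (real k)"
    using assms n by (intro mult_left_le_one_le) auto
  moreover have "ln (real n) = ln (real k) + ln y" using n k by (simp add: y_def ln_div)
  ultimately have le: "real k / real n * ln (real n) \<le> ln (real k) + 1"
    by (simp add: distrib_left)
  have "(n choose k) * fact k \<le> n ^ k" by (rule binomial_fact_pow)
  then have "real (n choose k) * fact k \<le> real n ^ k"
    by (metis of_nat_fact of_nat_le_iff of_nat_mult of_nat_power)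
  then have "real (n choose k) * fact k * real k ^ k \<le> real n ^ k * (exp (real k) * fact k)"
    using power_self_le_fact[of k] by (intro mult_mono) auto
  then have c: "real (n choose k) * real k ^ k \<le> real n ^ k * exp (real k)"
    by (simp add: mult.commute mult.left_commute)
  have e: "exp (- ((1 - real k / real n) * ln (real n)) * real k)
      = exp (real k / real n * ln (real n) * real k) * exp (- (real k * ln (real n)))"
    by (simp add: exp_add[symmetric] algebra_simps)
  have en: "exp (- (real k * ln (real n))) = 1 / real n ^ k"
    using n by (simp add: exp_minus exp_of_nat_mult field_simps)
  have "exp (real k / real n * ln (real n) * real k) \<le> exp ((ln (real k) + 1) * real k)"
    using le by (intro iffD2[OF exp_le_cancel_iff] mult_right_mono) auto
  also have "\<dots> = real k ^ k * exp (real k)"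
  proof -
    have "(ln (real k) + 1) * real k = real k * ln (real k) + real k" by (simp add: algebra_simps)
    then show ?thesis using k by (simp add: exp_add exp_of_nat_mult)
  qed
  finally have ek: "exp (real k / real n * ln (real n) * real k) \<le> real k ^ k * exp (real k)" .
  have "real (n choose k) * exp (- ((1 - real k / real n) * ln (real n)) * real k)
      \<le> real (n choose k) * (real k ^ k * exp (real k) * (1 / real n ^ k))"
    unfolding e en using ek by (intro mult_left_mono mult_right_mono) auto
  also have "\<dots> = (real (n choose k) * real k ^ k) * (exp (real k) / real n ^ k)" by simp
  also have "\<dots> \<le> (real n ^ k * exp (real k)) * (exp (real k) / real n ^ k)"
    using c by (intro mult_right_mono) auto
  also have "\<dots> = exp (2 * real k)" using n by (simp add: exp_add[symmetric])
  finally show ?thesis .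
qed

lemma geometric_bound:
  assumes "0 \<le> r" "r \<le> (1 / 2 :: real)"
  shows "(\<Sum>k\<in>{m..<N}. r ^ k) \<le> 2 * r ^ m"
proof (cases "m \<le> N")
  case True
  then have "(1 - r) * (\<Sum>k\<in>{m..<N}. r ^ k) = r ^ m - r ^ N"
  proof (induction rule: dec_induct)
    case (step N)
    then have "(1 - r) * (\<Sum>k\<in>{m..<Suc N}. r ^ k) = (r ^ m - r ^ N) + (1 - r) * r ^ N"
      by (simp add: distrib_left)
    then show ?case by (simp add: algebra_simps)
  qed simp
  moreover have "1 / 2 * (\<Sum>k\<in>{m..<N}. r ^ k) \<le> (1 - r) * (\<Sum>k\<in>{m..<N}. r ^ k)"
    using assms by (intro mult_right_mono sum_nonneg) auto
  moreover have "0 \<le> r ^ N" using assms by simp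
  ultimately show ?thesis by linarith
qed (use assms in simp)

text \<open>Linear growth of \<open>gap\<close> up to n/2 and reflection beyond it bound the sum by
  two geometric series of ratio r <= 1/2, each at most 2r.\<close>

lemma gap_weight_sum:
  assumes n: "n > 0" and X: "0 \<le> X" "exp (- (X * gap n 1)) \<le> 1 / 2"
  shows "(\<Sum>a\<in>{1..<int n}. exp (- (X * gap n a))) \<le> 4 * exp (- (X * gap n 1))"
proof -
  define r where "r = exp (- (X * gap n 1))"
  have r: "0 \<le> r" "r \<le> 1 / 2" using X by (auto simp: r_def)
  have half: "exp (- (X * gap n (int a))) \<le> r ^ a" if "2 * a \<le> n" for a
  proof -
    have "X * (real a * gap n 1) \<le> X * gap n (int a)"
      by (intro mult_left_mono gap_ge_linear that X)
    then have "exp (- (X * gap n (int a))) \<le> exp (real a * - (X * gap n 1))"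
      by (simp add: algebra_simps)
    then show ?thesis by (simp only: r_def exp_of_nat_mult)
  qed
  have "exp (- (X * gap n (int a))) \<le> r ^ a + r ^ (n - a)" if "a < n" for a
  proof (cases "2 * a \<le> n")
    case True
    then show ?thesis using half[OF True] r by (simp add: add_increasing2)
  next
    case False
    then have "exp (- (X * gap n (int (n - a)))) \<le> r ^ (n - a)" by (intro half) simp
    moreover have "gap n (int (n - a)) = gap n (int a)" using gap_reflect[OF n] that by simp
    ultimately show ?thesis using r by (simp add: add_increasing)
  qed
  then have "(\<Sum>a\<in>{1..<n}. exp (- (X * gap n (int a)))) \<le> (\<Sum>a\<in>{1..<n}. r ^ a + r ^ (n - a))"
    by (intro sum_mono) auto
  also have "\<dots> = (\<Sum>a\<in>{1..<n}. r ^ a) + (\<Sum>a\<in>{1..<n}. r ^ (n - a))" by (rule sum.distrib)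
  also have "(\<Sum>a\<in>{1..<n}. r ^ (n - a)) = (\<Sum>a\<in>{1..<n}. r ^ a)"
    by (rule sum.reindex_bij_witness[of _ "\<lambda>a. n - a" "\<lambda>a. n - a"]) auto
  also have "(\<Sum>a\<in>{1..<n}. r ^ a) \<le> 2 * r ^ 1" by (rule geometric_bound[OF r])
  finally have "(\<Sum>a\<in>{1..<n}. exp (- (X * gap n (int a)))) \<le> 4 * r" by simp
  moreover have "(\<Sum>a\<in>{1..<int n}. exp (- (X * gap n a))) = (\<Sum>a\<in>{1..<n}. exp (- (X * gap n (int a))))"
    by (rule sum.reindex_bij_witness[of _ int nat]) auto
  ultimately show ?thesis by (simp add: r_def)
qed

text \<open>The budget of four units of exp(-2c): one for spread exponents, one for k = 1, and two
  for the geometric tail k >= 2.\<close>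

lemma upper_estimate:
  fixes n t :: nat and c :: real
  assumes n: "3 \<le> n" and c: "5 / 4 \<le> c"
    and t: "1 / (4 * pi\<^sup>2) * real n ^ 3 * ln (real n) + c * real n ^ 3 \<le> real t"
  defines "w \<equiv> \<lambda>k. \<Sum>a\<in>{1..<int n}. exp (- (2 * real t * real (n - k) / (real n)\<^sup>2 * gap n a))"
  shows "real n ^ n * exp (- (real t * gap n 2 / 2))
         + (\<Sum>k | 1 \<le> k \<and> k \<le> n \<and> n < 6 * (n - k). real (n choose k) * w k ^ k)
       \<le> 4 * exp (- (2 * c))"
proof -
  have n0: "real n > 0" "real n \<ge> 3" using n by auto
  have L0: "0 \<le> ln (real n)" "ln (real n) \<le> real n" using n0 ln_le_minus_one[of "real n"] by auto
  \<comment> \<open>Relative error in the quadratic bound for \<open>gap n 1\<close>, from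
    \<open>3 \<le> n\<close> and \<open>pi\<^sup>2 \<le> 79/8\<close>. Even multiplied by ln n it
    stays bounded, because ln n <= n.\<close>
  have pn: "pi\<^sup>2 / (3 * (real n)\<^sup>2) \<le> 79 / 216" "ln (real n) * (pi\<^sup>2 / (3 * (real n)\<^sup>2)) \<le> 79 / 72"
  proof -
    have "9 \<le> (real n)\<^sup>2" using power_mono[of 3 "real n" 2] n0 by simp
    then have "pi\<^sup>2 / (3 * (real n)\<^sup>2) \<le> (79 / 8) / (3 * 9)"
      using pi_squared_bounds by (intro frac_le) auto
    then show "pi\<^sup>2 / (3 * (real n)\<^sup>2) \<le> 79 / 216" by simp
    have "ln (real n) * (pi\<^sup>2 / (3 * (real n)\<^sup>2)) \<le> real n * (pi\<^sup>2 / (3 * (real n)\<^sup>2))"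
      using L0 by (intro mult_right_mono) auto
    also have "\<dots> = pi\<^sup>2 / (3 * real n)" using n0 by (simp add: power2_eq_square)
    also have "\<dots> \<le> (79 / 8) / (3 * 3)" using pi_squared_bounds n0 by (intro frac_le) auto
    finally show "ln (real n) * (pi\<^sup>2 / (3 * (real n)\<^sup>2)) \<le> 79 / 72" by simp
  qed
  define Q where "Q = ln (real n) / (4 * pi\<^sup>2) + c"
  have Q0: "0 \<le> Q" using L0 c by (simp add: Q_def)
  have tQ: "real n ^ 3 * Q \<le> real t" using t by (simp add: Q_def algebra_simps)
  have g1: "2 * pi\<^sup>2 / (real n)\<^sup>2 * (1 - pi\<^sup>2 / (3 * (real n)\<^sup>2)) \<le> gap n 1"
  proof -
    have "pi\<^sup>2 \<le> 6 * (real n)\<^sup>2" using pi_squared_bounds power_mono[of 3 "real n" 2] n0 by simp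
    then show ?thesis using gap_ge_quadratic[of 1 n] n by simp
  qed
  have main: "real n * (ln (real n) + 23 * c) \<le> 2 * real t * gap n 1"
  proof -
    have "ln (real n) + 23 * c \<le> 4 * pi\<^sup>2 * Q * (1 - pi\<^sup>2 / (3 * (real n)\<^sup>2))"
    proof -
      have "4 * pi\<^sup>2 * Q = ln (real n) + 4 * pi\<^sup>2 * c" by (simp add: Q_def field_simps)
      \<comment> \<open>Here 196/5 = 4 * 49/5 and 137/216 = 1 - 79/216. The product exceeds 24, and
        the surplus over 23 pays for the loss 79/72 in the logarithmic term.\<close>
      moreover have "(196 / 5) * c * (137 / 216) \<le> 4 * pi\<^sup>2 * c * (1 - pi\<^sup>2 / (3 * (real n)\<^sup>2))"
        using pn pi_squared_bounds c by (intro mult_mono) auto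
      moreover have "ln (real n) * (1 - pi\<^sup>2 / (3 * (real n)\<^sup>2)) \<ge> ln (real n) - 79 / 72"
        using pn(2) unfolding right_diff_distrib by simp
      ultimately show ?thesis using c by (simp only: distrib_right)
    qed
    then have "real n * (ln (real n) + 23 * c) \<le> real n * (4 * pi\<^sup>2 * Q * (1 - pi\<^sup>2 / (3 * (real n)\<^sup>2)))"
      by (rule mult_left_mono) simp
    also have "\<dots> = 2 * (real n ^ 3 * Q) * (2 * pi\<^sup>2 / (real n)\<^sup>2 * (1 - pi\<^sup>2 / (3 * (real n)\<^sup>2)))"
      using n0 by (simp add: power2_eq_square power3_eq_cube)
    also have "\<dots> \<le> 2 * (real n ^ 3 * Q) * gap n 1"
      using g1 Q0 by (intro mult_left_mono) auto
    also have "\<dots> \<le> 2 * real t * gap n 1" using tQ by (intro mult_right_mono) auto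
    finally show ?thesis .
  qed
  have "real n * ln (real n) + 11 * c \<le> real t * gap n 2 / 2"
  proof (cases "n = 3")
    case True
    \<comment> \<open>For n = 3 the quadratic lower bound at a = 2 is negative, so the reflected
      value and \<open>main\<close> are used instead.\<close>
    have "gap 3 2 = gap 3 1" using gap_reflect[of 3 1] by simp
    then show ?thesis using main True L0 c by simp
  next
    case False
    then have n4: "real n \<ge> 4" using n by simp
    define d where "d = 4 * pi\<^sup>2 / (3 * (real n)\<^sup>2)"
    have n16: "16 \<le> (real n)\<^sup>2" using power_mono[of 4 "real n" 2] n4 by simp
    have d: "d \<le> 79 / 96" "ln (real n) * real n * d \<le> 79 / 6"
    proof -
      have "d \<le> (4 * (79 / 8)) / (3 * 16)"
        unfolding d_def using pi_squared_bounds n16 by (intro frac_le) auto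
      then show "d \<le> 79 / 96" by simp
      have "ln (real n) * real n * d \<le> real n * real n * d"
        using L0 by (intro mult_right_mono) (auto simp: d_def)
      also have "\<dots> = 4 * pi\<^sup>2 / 3" using n0 by (simp add: d_def power2_eq_square)
      finally show "ln (real n) * real n * d \<le> 79 / 6" using pi_squared_bounds by simp
    qed
    have g2: "8 * pi\<^sup>2 / (real n)\<^sup>2 * (1 - d) \<le> gap n 2"
    proof -
      have "(pi * real 2)\<^sup>2 \<le> 6 * (real n)\<^sup>2" using pi_squared_bounds n16 by (simp add: power_mult_distrib)
      then show ?thesis using gap_ge_quadratic[of 2 n] n by (simp add: power_mult_distrib d_def mult.commute)
    qed
    \<comment> \<open>The factor 4 is the bound on n and 17/96 = 1 - 79/96. The product exceeds 27c,
      enough for 11c after the loss 79/6 in the logarithmic term.\<close>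
    have "196 / 5 * c * 4 * (17 / 96) \<le> 4 * pi\<^sup>2 * c * real n * (1 - d)"
      using d pi_squared_bounds c n4 by (intro mult_mono) auto
    then have "real n * ln (real n) + 11 * c \<le> real n * ln (real n) * (1 - d) + 4 * pi\<^sup>2 * c * real n * (1 - d)"
      using d(2) c by (simp add: algebra_simps)
    also have "\<dots> = real n ^ 3 * Q * (8 * pi\<^sup>2 / (real n)\<^sup>2 * (1 - d)) / 2"
      using n0 by (simp add: Q_def power2_eq_square power3_eq_cube field_simps)
    also have "\<dots> \<le> real n ^ 3 * Q * gap n 2 / 2"
      using g2 Q0 by (intro divide_right_mono mult_left_mono) auto
    also have "\<dots> \<le> real t * gap n 2 / 2"
      using tQ by (intro divide_right_mono mult_right_mono) auto
    finally show ?thesis .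
  qed
  then have "real n ^ n * exp (- (real t * gap n 2 / 2)) \<le> real n ^ n * exp (- (real n * ln (real n) + 11 * c))"
    by (intro mult_left_mono) auto
  also have "\<dots> = exp (- (11 * c))"
    using n0 by (simp add: exp_add exp_minus exp_of_nat_mult minus_add_distrib exp_diff field_simps)
  also have "\<dots> \<le> exp (- (2 * c))" using c by simp
  finally have part1: "real n ^ n * exp (- (real t * gap n 2 / 2)) \<le> exp (- (2 * c))" .
  define K where "K = {k. 1 \<le> k \<and> k \<le> n \<and> n < 6 * (n - k)}"
  \<comment> \<open>The constant 7/2 collects 3/2, from 4 <= exp(3/2) in the weight sum, and 2 from
    \<open>binomial_exp_bound\<close>.\<close>
  have term_bound: "real (n choose k) * w k ^ k \<le> exp (7 / 2 - 23 * c * (1 - real k / real n)) ^ k" if k: "k \<in> K" for k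
  proof -
    define z where "z = 1 - real k / real n"
    have kn: "1 \<le> k" "k \<le> n" "n < 6 * (n - k)" using k by (auto simp: K_def)
    have z: "real (n - k) = real n * z" using kn n0 by (simp add: z_def field_simps of_nat_diff)
    have z6: "1 / 6 \<le> z"
    proof -
      have "real n \<le> 6 * (real n * z)" using kn(3) unfolding z[symmetric] by linarith
      then show ?thesis using n0 by simp
    qed
    define X where "X = 2 * real t * real (n - k) / (real n)\<^sup>2"
    have Xg: "z * (ln (real n) + 23 * c) \<le> X * gap n 1"
    proof -
      have "X * gap n 1 = z * (2 * real t * gap n 1 / real n)"
        using n0 unfolding X_def z by (simp add: power2_eq_square)
      moreover have "ln (real n) + 23 * c \<le> 2 * real t * gap n 1 / real n"
        using main n0 by (simp add: field_simps)
      ultimately show ?thesis using mult_left_mono[of _ "2 * real t * gap n 1 / real n" z] z6 by simp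
    qed
    \<comment> \<open>115/4 = 23 * 5/4. The product is well above 1, so the ratio of the geometric
      series is at most 1/2.\<close>
    have "1 / 6 * (115 / 4) \<le> z * (ln (real n) + 23 * c)"
      using z6 L0 c by (intro mult_mono) auto
    then have "1 \<le> X * gap n 1" using Xg by linarith
    then have "2 \<le> exp (X * gap n 1)" using exp_ge_add_one_self[of "X * gap n 1"] by linarith
    then have "exp (- (X * gap n 1)) \<le> 1 / 2" by (simp add: exp_minus field_simps)
    then have "w k \<le> 4 * exp (- (X * gap n 1))"
      unfolding w_def X_def[symmetric] using n by (intro gap_weight_sum) (auto simp: X_def)
    also have "\<dots> \<le> exp (3 / 2) * exp (- (z * (ln (real n) + 23 * c)))"
      using Xg four_le_exp_three_halves by (intro mult_mono) auto
    finally have wk: "w k \<le> exp (3 / 2) * exp (- (z * (ln (real n) + 23 * c)))" .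
    have "0 \<le> w k" unfolding w_def by (intro sum_nonneg) auto
    then have "real (n choose k) * w k ^ k \<le> real (n choose k) * (exp (3 / 2) * exp (- (z * (ln (real n) + 23 * c)))) ^ k"
      using wk by (intro mult_left_mono power_mono) auto
    also have "(exp (3 / 2) * exp (- (z * (ln (real n) + 23 * c)))) ^ k
        = exp (- (z * ln (real n)) * real k) * exp (3 / 2 - 23 * c * z) ^ k"
      by (simp add: exp_of_nat_mult[symmetric] exp_add[symmetric] algebra_simps)
    also have "real (n choose k) * (exp (- (z * ln (real n)) * real k) * exp (3 / 2 - 23 * c * z) ^ k)
        \<le> exp (2 * real k) * exp (3 / 2 - 23 * c * z) ^ k"
      using binomial_exp_bound[OF kn(1,2)] unfolding z_def[symmetric] mult.assoc[symmetric]
      by (intro mult_right_mono) auto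
    also have "\<dots> = exp (7 / 2 - 23 * c * z) ^ k"
      by (simp add: exp_of_nat_mult[symmetric] exp_add[symmetric] algebra_simps)
    finally show ?thesis by (simp add: z_def)
  qed
  \<comment> \<open>This is the base for the worst admissible k, where 1 - k/n is about 1/6.\<close>
  define \<rho> where "\<rho> = exp (7 / 2 - 23 / 6 * c)"
  have \<rho>: "0 \<le> \<rho>" "\<rho> \<le> 1 / 2"
  proof -
    have "2 \<le> exp (23 / 6 * c - 7 / 2)" using exp_ge_add_one_self[of "23 / 6 * c - 7 / 2"] c by linarith
    then have "inverse (exp (23 / 6 * c - 7 / 2)) \<le> 1 / 2" by (simp add: field_simps)
    then show "\<rho> \<le> 1 / 2" unfolding \<rho>_def exp_minus[symmetric] by simp
  qed (simp add: \<rho>_def)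
  have "(\<Sum>k\<in>K. real (n choose k) * w k ^ k) \<le> (\<Sum>k\<in>K. if k = 1 then exp (- (2 * c)) else \<rho> ^ k)"
  proof (rule sum_mono)
    fix k assume k: "k \<in> K"
    show "real (n choose k) * w k ^ k \<le> (if k = 1 then exp (- (2 * c)) else \<rho> ^ k)"
    proof (cases "k = 1")
      case True
      \<comment> \<open>The single power of \<open>\<rho>\<close> need not be below exp(-2c), so k =
        1 uses the better factor 1 - 1/n >= 2/3.\<close>
      have "1 / real n \<le> 1 / 3" using n0 by (intro frac_le) auto
      then have "23 * c * (2 / 3) \<le> 23 * c * (1 - real k / real n)" using c True by (intro mult_left_mono) auto
      then have "7 / 2 - 23 * c * (1 - real k / real n) \<le> 7 / 2 - 23 * c * (2 / 3)" by (rule diff_left_mono)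
      also have "\<dots> \<le> - (2 * c)" using c by simp
      finally have "exp (7 / 2 - 23 * c * (1 - real k / real n)) \<le> exp (- (2 * c))" by (rule iffD2[OF exp_le_cancel_iff])
      then have "exp (7 / 2 - 23 * c * (1 - real k / real n)) ^ k \<le> exp (- (2 * c))"
        unfolding True power_one_right .
      with term_bound[OF k] show ?thesis unfolding if_P[OF True] by (rule order_trans)
    next
      case False
      have "n < 6 * (n - k)" "k \<le> n" using k by (auto simp: K_def)
      then have "n + 6 * k \<le> 6 * n" by linarith
      then have "real (n + 6 * k) \<le> real (6 * n)" by (simp only: of_nat_le_iff)
      then have "1 / 6 \<le> 1 - real k / real n" using n0 by (simp add: field_simps)
      then have "23 * c * (1 / 6) \<le> 23 * c * (1 - real k / real n)" using c by (intro mult_left_mono) auto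
      then have "exp (7 / 2 - 23 * c * (1 - real k / real n)) ^ k \<le> \<rho> ^ k"
        unfolding \<rho>_def by (intro power_mono) auto
      with term_bound[OF k] show ?thesis unfolding if_not_P[OF False] by (rule order_trans)
    qed
  qed
  also have "\<dots> \<le> (\<Sum>k\<in>insert 1 {2..<Suc n}. if k = 1 then exp (- (2 * c)) else \<rho> ^ k)"
    using \<rho> by (intro sum_mono2) (auto simp: K_def)
  also have "\<dots> = exp (- (2 * c)) + (\<Sum>k\<in>{2..<Suc n}. \<rho> ^ k)"
    by (subst sum.insert) (auto intro!: sum.cong)
  also have "(\<Sum>k\<in>{2..<Suc n}. \<rho> ^ k) \<le> 2 * \<rho> ^ 2" by (rule geometric_bound[OF \<rho>])
  \<comment> \<open>The comparison 7 - 23c/3 <= -2c means c >= 21/17, only slightly below the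
    assumed 5/4.\<close>
  also have "\<rho> ^ 2 \<le> exp (- (2 * c))"
  proof -
    have "\<rho> ^ 2 = exp (2 * (7 / 2 - 23 / 6 * c))" unfolding \<rho>_def by (simp only: exp_double)
    then show ?thesis using c by simp
  qed
  finally have "(\<Sum>k\<in>K. real (n choose k) * w k ^ k) \<le> 3 * exp (- (2 * c))" by simp
  then show ?thesis using part1 unfolding K_def by simp
qed

section \<open>The second moment method\<close>

lemma gap_1_le: "gap n 1 \<le> 2 * pi\<^sup>2 / (real n)\<^sup>2"
proof -
  have "(sin (pi / real n))\<^sup>2 \<le> (pi / real n)\<^sup>2"
    by (rule abs_le_square_iff[THEN iffD1, OF abs_sin_x_le_abs_x])
  then show ?thesis by (simp add: gap_eq_sin power_divide)
qed

lemma zeta_1_real_part: "zeta n 1 + zeta n (- 1) = of_real (2 * (1 - gap n 1))"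
  by (simp add: zeta_uminus complex_add_cnj gap_eq_Re)

context complete_sandpile
begin

section \<open>Eigenvalues of the characters occurring in the statistic and its square\<close>

definition swap :: "'a \<Rightarrow> 'a \<Rightarrow> 'a \<Rightarrow> int" where
  "swap u v = (\<lambda>w. (if w = u then 1 else 0) - (if w = v then 1 else 0))"

lemma balanced_add: "balanced i \<Longrightarrow> balanced j \<Longrightarrow> balanced (\<lambda>v. i v + j v)"
  by (simp add: balanced_def sum.distrib)

lemma balanced_swap: "u \<in> nonsink \<Longrightarrow> v \<in> nonsink \<Longrightarrow> balanced (swap u v)"
  by (auto simp: balanced_def swap_def sum_subtractf sum.delta)

lemma pairing_swap:
  assumes "u \<in> nonsink" "v \<in> nonsink"
  shows "pairing (swap u v) \<eta> = int (\<eta> u) - int (\<eta> v)"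
proof -
  have "pairing (swap u v) \<eta> = (\<Sum>w\<in>nonsink. (if w = u then int (\<eta> w) else 0) - (if w = v then int (\<eta> w) else 0))"
    unfolding pairing_def swap_def by (intro sum.cong) auto
  with assms show ?thesis by (simp add: sum_subtractf sum.delta)
qed

lemma chi_add: "chi (\<lambda>v. i v + j v) \<eta> = chi i \<eta> * chi j \<eta>"
  by (simp add: chi_def pairing_def algebra_simps sum.distrib zeta_add)

text \<open>Dividing by the character at the initial state removes the phase, so the mean under the
  chain is a pure eigenvalue power.\<close>

definition ratio :: "('a \<Rightarrow> nat) \<Rightarrow> ('a \<Rightarrow> int) \<Rightarrow> ('a \<Rightarrow> nat) \<Rightarrow> complex" where
  "ratio \<sigma> j \<eta> = chi j \<eta> * cnj (chi j \<sigma>)"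

lemma ratio_add: "ratio \<sigma> (\<lambda>v. i v + j v) \<eta> = ratio \<sigma> i \<eta> * ratio \<sigma> j \<eta>"
  by (simp add: ratio_def chi_add)

lemma sum_pmf_ratio:
  assumes "balanced j" "\<sigma> \<in> recurrent"
  shows "(\<Sum>\<eta>\<in>recurrent. of_real (pmf (chain_dist \<sigma> t) \<eta>) * ratio \<sigma> j \<eta>) = eigenvalue j ^ t"
  using sum_pmf_chi[OF assms, of t]
  by (simp add: ratio_def sum_distrib_right[symmetric] mult.assoc[symmetric])

lemma eigenvalue_support:
  assumes "A \<subseteq> verts G" "\<And>w. w \<in> verts G - A \<Longrightarrow> j w = 0"
  shows "eigenvalue j = (of_nat n + (\<Sum>w\<in>A. zeta n (j w) - 1)) / of_nat n"
proof -
  have "(\<Sum>w\<in>verts G. zeta n (j w) - 1) = (\<Sum>w\<in>A. zeta n (j w) - 1)"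
    using assms by (intro sum.mono_neutral_right) auto
  then show ?thesis
    by (simp add: eigenvalue_def sum_subtractf card_verts algebra_simps)
qed

lemma norm_eigenvalue_le_1: "cmod (eigenvalue j) \<le> 1"
proof -
  have "cmod (\<Sum>v\<in>verts G. zeta n (j v)) \<le> (\<Sum>v\<in>verts G. cmod (zeta n (j v)))" by (rule norm_sum)
  then show ?thesis using n_pos by (simp add: eigenvalue_def norm_divide card_verts)
qed

definition lam :: real where "lam = 1 - 2 * gap n 1 / real n"

lemma eigenvalue_swap:
  assumes "u \<in> nonsink" "v \<in> nonsink" "u \<noteq> v"
  shows "eigenvalue (swap u v) = of_real lam"
proof -
  have "eigenvalue (swap u v) = (of_nat n + ((zeta n 1 + zeta n (- 1)) - 2)) / of_nat n"
    using assms by (subst eigenvalue_support[of "{u, v}"]) (auto simp: swap_def algebra_simps)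
  also have "\<dots> = of_real ((real n + (2 * (1 - gap n 1) - 2)) / real n)"
    unfolding zeta_1_real_part by simp
  also have "(real n + (2 * (1 - gap n 1) - 2)) / real n = lam"
    using n_pos by (simp add: lam_def field_simps)
  finally show ?thesis .
qed

lemma eigenvalue_uminus: "eigenvalue (\<lambda>v. - j v) = cnj (eigenvalue j)"
  by (simp add: eigenvalue_def zeta_uminus)

text \<open>The exponents are 2, -1, -1 and n - 3 zeros. Grouping \<open>zeta n 2\<close> with one
  of the ones as \<open>zeta n 1 * (zeta n 1 + zeta n (- 1))\<close> makes the triangle inequality
  give \<open>lam\<close> exactly.\<close>

lemma norm_eigenvalue_shared:
  assumes "u \<in> nonsink" "v \<in> nonsink" "w \<in> nonsink" "u \<noteq> v" "u \<noteq> w" "v \<noteq> w"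
    and n: "4 \<le> n" and g: "gap n 1 \<le> 1"
  shows "cmod (eigenvalue (\<lambda>x. swap u v x + swap u w x)) \<le> lam"
proof -
  let ?z = "zeta n"
  have "eigenvalue (\<lambda>x. swap u v x + swap u w x) = (of_nat n + (?z 2 + 2 * ?z (- 1) - 3)) / of_nat n"
    using assms by (subst eigenvalue_support[of "{u, v, w}"]) (auto simp: swap_def algebra_simps)
  also have "of_nat n + (?z 2 + 2 * ?z (- 1) - 3) = of_nat (n - 4) + ?z 1 * (?z 1 + ?z (- 1)) + 2 * ?z (- 1)"
    using n zeta_add[of n 1 1] zeta_add[of n 1 "- 1"] by (simp add: distrib_left of_nat_diff)
  finally have "cmod (eigenvalue (\<lambda>x. swap u v x + swap u w x))
      = cmod (of_nat (n - 4) + ?z 1 * of_real (2 * (1 - gap n 1)) + 2 * ?z (- 1)) / real n"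
    unfolding zeta_1_real_part by (simp only: norm_divide norm_of_nat)
  also have "\<dots> \<le> (cmod (of_nat (n - 4)) + cmod (?z 1 * of_real (2 * (1 - gap n 1))) + cmod (2 * ?z (- 1))) / real n"
    by (intro divide_right_mono order_trans[OF norm_triangle_ineq] add_right_mono norm_triangle_ineq) simp
  also have "\<dots> = (real (n - 4) + 2 * (1 - gap n 1) + 2) / real n"
    using g unfolding norm_mult norm_zeta norm_of_real norm_of_nat by simp
  also have "\<dots> = lam" using n by (simp add: lam_def of_nat_diff field_simps)
  finally show ?thesis .
qed

text \<open>The eigenvalue is 1 - 4g/n, below (1 - 2g/n)^2 = lam^2; thus disjoint pairs add nothing
  to the variance bound.\<close>

lemma norm_eigenvalue_disjoint:
  assumes "{u, v, w, x} \<subseteq> nonsink" "distinct [u, v, w, x]" and g: "4 * gap n 1 \<le> real n"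
  shows "cmod (eigenvalue (\<lambda>y. swap u v y + swap w x y)) \<le> lam\<^sup>2"
proof -
  have "eigenvalue (\<lambda>y. swap u v y + swap w x y)
      = (of_nat n + (2 * (zeta n 1 + zeta n (- 1)) - 4)) / of_nat n"
    using assms by (subst eigenvalue_support[of "{u, v, w, x}"]) (auto simp: swap_def algebra_simps)
  also have "\<dots> = of_real ((real n + (2 * (2 * (1 - gap n 1)) - 4)) / real n)"
    unfolding zeta_1_real_part by simp
  also have "(real n + (2 * (2 * (1 - gap n 1)) - 4)) / real n = 1 - 4 * gap n 1 / real n"
    using n_pos by (simp add: field_simps)
  finally have "cmod (eigenvalue (\<lambda>y. swap u v y + swap w x y)) = \<bar>1 - 4 * gap n 1 / real n\<bar>"
    by (simp only: norm_of_real)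
  also have "\<dots> = 1 - 4 * gap n 1 / real n" using g n_pos by (simp add: field_simps)
  also have "\<dots> \<le> 1 - 4 * gap n 1 / real n + (2 * gap n 1 / real n)\<^sup>2" by simp
  also have "\<dots> = lam\<^sup>2" by (simp add: lam_def power2_eq_square algebra_simps)
  finally show ?thesis .
qed

text \<open>The indicators record how two ordered pairs overlap: disjoint pairs cost
  \<open>T\<^sup>2\<close>, one common vertex costs \<open>T\<close>, and equal or reversed pairs
  get the trivial bound 1.\<close>

lemma norm_eigenvalue_pair:
  fixes t :: nat
  assumes V: "u \<in> nonsink" "v \<in> nonsink" "u \<noteq> v" "u' \<in> nonsink" "v' \<in> nonsink" "u' \<noteq> v'"
    and n: "4 \<le> n" and g: "gap n 1 \<le> 1"
  defines "T \<equiv> lam ^ t"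
  shows "cmod (eigenvalue (\<lambda>x. swap u v x + swap u' v' x)) ^ t
    \<le> T\<^sup>2 + (of_bool (u = u') * T + of_bool (v = v') * T + of_bool (u = v') * T + of_bool (v = u') * T)
       + (of_bool (u = u' \<and> v = v') + of_bool (u = v' \<and> v = u'))"
proof -
  let ?e = "eigenvalue (\<lambda>x. swap u v x + swap u' v' x)"
  have "0 \<le> lam" using n g by (simp add: lam_def field_simps)
  then have T: "0 \<le> T" by (simp add: T_def)
  have one: "cmod ?e ^ t \<le> 1" using norm_eigenvalue_le_1 by (intro power_le_one) auto
  have le_T: "cmod ?e ^ t \<le> T" if "cmod ?e \<le> lam" using that unfolding T_def by (intro power_mono) auto
  have swap_comp: "(\<lambda>x. swap a b x + swap b c x) = swap a c" "(\<lambda>x. swap a b x + swap c a x) = swap c b" for a b c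
    by (auto simp: swap_def fun_eq_iff)
  consider "u = u'" "v = v'" | "u = v'" "v = u'" | "u = u'" "v \<noteq> v'" | "v = v'" "u \<noteq> u'"
    | "u = v'" "v \<noteq> u'" | "v = u'" "u \<noteq> v'" | "distinct [u, v, u', v']" using V by auto
  then show ?thesis
  proof cases
    case 1
    then show ?thesis using one T V by (simp add: add_increasing)
  next
    case 2
    then show ?thesis using one T V by (simp add: add_increasing)
  next
    case 3
    then have "cmod ?e \<le> lam" using norm_eigenvalue_shared[of u v v'] V n g by simp
    then show ?thesis using le_T 3 T V by (simp add: add_increasing)
  next
    case 4
    \<comment> \<open>Negating the exponent conjugates the eigenvalue and turns a common second
      entry into a common first entry.\<close>
    have "?e = eigenvalue (\<lambda>x. - (swap v u x + swap v u' x))"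
      using 4 by (intro arg_cong[where f = eigenvalue]) (auto simp: swap_def fun_eq_iff)
    then have "cmod ?e \<le> lam" using norm_eigenvalue_shared[of v u u'] V n g 4 unfolding eigenvalue_uminus by simp
    then show ?thesis using le_T 4 T V by (simp add: add_increasing)
  next
    case 5
    then have "cmod ?e = \<bar>lam\<bar>" using eigenvalue_swap[of u' v] V by (simp add: swap_comp norm_of_real del: of_real_diff)
    then show ?thesis using le_T 5 T V \<open>0 \<le> lam\<close> by (simp add: add_increasing)
  next
    case 6
    then have "cmod ?e = \<bar>lam\<bar>" using eigenvalue_swap[of u v'] V by (simp add: swap_comp norm_of_real)
    then show ?thesis using le_T 6 T V \<open>0 \<le> lam\<close> by (simp add: add_increasing)
  next
    case 7
    then have "cmod ?e \<le> lam\<^sup>2" using V n g by (intro norm_eigenvalue_disjoint) auto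
    then have "cmod ?e ^ t \<le> (lam\<^sup>2) ^ t" by (intro power_mono) auto
    also have "\<dots> = T\<^sup>2" by (simp add: T_def power_mult[symmetric] mult.commute)
    finally show ?thesis using 7 T by auto
  qed
qed

section \<open>The statistic and its first two moments\<close>

definition pairs :: "('a \<times> 'a) set" where
  "pairs = {(u, v). u \<in> nonsink \<and> v \<in> nonsink \<and> u \<noteq> v}"

lemma finite_pairs: "finite pairs"
  by (rule finite_subset[of _ "nonsink \<times> nonsink"]) (auto simp: pairs_def)

lemma pairs_Sigma: "pairs = Sigma nonsink (\<lambda>u. nonsink - {u})"
  by (auto simp: pairs_def)

lemma card_pairs: "card pairs = (n - 1) * (n - 2)"
proof -
  have "card (nonsink - {u}) = n - 2" if "u \<in> nonsink" for u
    using that by (simp add: card_nonsink card_verts sink_in_verts)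
  then show ?thesis unfolding pairs_Sigma by (simp add: card_nonsink)
qed

definition stat :: "('a \<Rightarrow> nat) \<Rightarrow> ('a \<Rightarrow> nat) \<Rightarrow> real" where
  "stat \<sigma> \<eta> = (cmod (\<Sum>v\<in>nonsink. zeta n (int (\<eta> v) - int (\<sigma> v))))\<^sup>2 - real (n - 1)"

lemma stat_eq_sum_ratio: "of_real (stat \<sigma> \<eta>) = (\<Sum>(u, v)\<in>pairs. ratio \<sigma> (swap u v) \<eta>)"
proof -
  define d where "d = (\<lambda>v. int (\<eta> v) - int (\<sigma> v))"
  have "of_real ((cmod (\<Sum>v\<in>nonsink. zeta n (d v)))\<^sup>2) = (\<Sum>u\<in>nonsink. \<Sum>v\<in>nonsink. zeta n (d u - d v))"
    unfolding complex_norm_square by (simp only: cnj_sum sum_product zeta_diff)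
  also have "\<dots> = (\<Sum>u\<in>nonsink. 1 + (\<Sum>v\<in>nonsink - {u}. zeta n (d u - d v)))"
    by (intro sum.cong refl) (subst sum.remove, auto)
  also have "\<dots> = of_nat (n - 1) + (\<Sum>u\<in>nonsink. \<Sum>v\<in>nonsink - {u}. zeta n (d u - d v))"
    by (simp add: sum.distrib card_nonsink)
  also have "(\<Sum>u\<in>nonsink. \<Sum>v\<in>nonsink - {u}. zeta n (d u - d v)) = (\<Sum>(u, v)\<in>pairs. zeta n (d u - d v))"
    unfolding pairs_Sigma by (rule sum.Sigma) auto
  also have "\<dots> = (\<Sum>(u, v)\<in>pairs. ratio \<sigma> (swap u v) \<eta>)"
  proof (rule sum.cong[OF refl], clarify)
    fix u v assume "(u, v) \<in> pairs"
    then show "zeta n (d u - d v) = ratio \<sigma> (swap u v) \<eta>"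
      by (simp add: pairs_def ratio_def chi_def pairing_swap zeta_diff[symmetric] d_def algebra_simps)
  qed
  finally show ?thesis by (simp add: stat_def d_def)
qed

lemma stat_mean:
  assumes "\<sigma> \<in> recurrent"
  shows "(\<Sum>\<eta>\<in>recurrent. pmf (chain_dist \<sigma> t) \<eta> * stat \<sigma> \<eta>) = real ((n - 1) * (n - 2)) * lam ^ t"
proof -
  let ?p = "\<lambda>\<eta>. complex_of_real (pmf (chain_dist \<sigma> t) \<eta>)"
  have "complex_of_real (\<Sum>\<eta>\<in>recurrent. pmf (chain_dist \<sigma> t) \<eta> * stat \<sigma> \<eta>)
      = (\<Sum>\<eta>\<in>recurrent. \<Sum>x\<in>pairs. ?p \<eta> * ratio \<sigma> (swap (fst x) (snd x)) \<eta>)"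
    by (simp add: stat_eq_sum_ratio sum_distrib_left case_prod_beta)
  also have "\<dots> = (\<Sum>x\<in>pairs. \<Sum>\<eta>\<in>recurrent. ?p \<eta> * ratio \<sigma> (swap (fst x) (snd x)) \<eta>)"
    by (rule sum.swap)
  also have "\<dots> = (\<Sum>x\<in>pairs. of_real (lam ^ t))"
  proof (rule sum.cong[OF refl])
    fix x assume x: "x \<in> pairs"
    then have "balanced (swap (fst x) (snd x))" by (auto simp: pairs_def intro: balanced_swap)
    then show "(\<Sum>\<eta>\<in>recurrent. ?p \<eta> * ratio \<sigma> (swap (fst x) (snd x)) \<eta>) = of_real (lam ^ t)"
      using x by (auto simp: sum_pmf_ratio[OF _ assms] pairs_def eigenvalue_swap)
  qed
  also have "\<dots> = of_real (real ((n - 1) * (n - 2)) * lam ^ t)" by (simp add: card_pairs)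
  finally show ?thesis unfolding of_real_eq_iff .
qed

text \<open>The first term is the squared mean, so the others bound the variance. Each of four
  single coincidences leaves n - 2 choices for the second pair, and each of two full coincidences
  leaves one.\<close>

lemma stat_second_moment:
  assumes \<sigma>: "\<sigma> \<in> recurrent" and n: "4 \<le> n" and g: "gap n 1 \<le> 1"
  defines "N \<equiv> real ((n - 1) * (n - 2))"
  shows "(\<Sum>\<eta>\<in>recurrent. pmf (chain_dist \<sigma> t) \<eta> * (stat \<sigma> \<eta>)\<^sup>2)
    \<le> (N * lam ^ t)\<^sup>2 + 4 * N * real (n - 2) * lam ^ t + 2 * N"
proof -
  let ?p = "\<lambda>\<eta>. complex_of_real (pmf (chain_dist \<sigma> t) \<eta>)"
  define T where "T = lam ^ t"
  let ?j = "\<lambda>x y w. swap (fst x) (snd x) w + swap (fst y) (snd y) w"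
  have "complex_of_real ((stat \<sigma> \<eta>)\<^sup>2) = (\<Sum>x\<in>pairs. \<Sum>y\<in>pairs. ratio \<sigma> (?j x y) \<eta>)" for \<eta>
    unfolding power2_eq_square of_real_mult stat_eq_sum_ratio sum_product ratio_add case_prod_beta ..
  then have "complex_of_real (\<Sum>\<eta>\<in>recurrent. pmf (chain_dist \<sigma> t) \<eta> * (stat \<sigma> \<eta>)\<^sup>2)
      = (\<Sum>\<eta>\<in>recurrent. \<Sum>x\<in>pairs. \<Sum>y\<in>pairs. ?p \<eta> * ratio \<sigma> (?j x y) \<eta>)"
    by (simp only: of_real_sum of_real_mult sum_distrib_left)
  also have "\<dots> = (\<Sum>x\<in>pairs. \<Sum>y\<in>pairs. \<Sum>\<eta>\<in>recurrent. ?p \<eta> * ratio \<sigma> (?j x y) \<eta>)"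
    by (subst sum.swap, intro sum.cong refl, rule sum.swap)
  also have "\<dots> = (\<Sum>x\<in>pairs. \<Sum>y\<in>pairs. eigenvalue (?j x y) ^ t)"
    by (intro sum.cong refl sum_pmf_ratio[OF _ \<sigma>] balanced_add) (auto simp: pairs_def intro: balanced_swap)
  finally have "(\<Sum>\<eta>\<in>recurrent. pmf (chain_dist \<sigma> t) \<eta> * (stat \<sigma> \<eta>)\<^sup>2)
      = Re (\<Sum>x\<in>pairs. \<Sum>y\<in>pairs. eigenvalue (?j x y) ^ t)"
    by (metis Re_complex_of_real)
  also have "\<dots> \<le> (\<Sum>x\<in>pairs. \<Sum>y\<in>pairs. cmod (eigenvalue (?j x y)) ^ t)"
    unfolding Re_sum norm_power[symmetric] by (intro sum_mono complex_Re_le_cmod)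
  also have "\<dots> \<le> (\<Sum>x\<in>pairs. \<Sum>y\<in>pairs. T\<^sup>2 + (of_bool (fst x = fst y) * T + of_bool (snd x = snd y) * T
        + of_bool (fst x = snd y) * T + of_bool (snd x = fst y) * T)
        + (of_bool (fst x = fst y \<and> snd x = snd y) + of_bool (fst x = snd y \<and> snd x = fst y)))"
    unfolding T_def by (intro sum_mono norm_eigenvalue_pair n g) (auto simp: pairs_def)
  also have "\<dots> \<le> (\<Sum>x\<in>pairs. N * T\<^sup>2 + 4 * real (n - 2) * T + 2)"
  proof (rule sum_mono)
    fix x assume x: "x \<in> pairs"
    have "0 \<le> lam" using n g by (simp add: lam_def field_simps)
    then have T: "0 \<le> T" by (simp add: T_def)
    have cnt1: "(\<Sum>y\<in>pairs. of_bool (a = fst y)) = real (n - 2)"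
      "(\<Sum>y\<in>pairs. of_bool (a = snd y)) = real (n - 2)" if a: "a \<in> nonsink" for a
    proof -
      have "{y \<in> pairs. a = fst y} = Pair a ` (nonsink - {a})" "{y \<in> pairs. a = snd y} = (\<lambda>u. (u, a)) ` (nonsink - {a})"
        using a by (auto simp: pairs_def image_iff)
      moreover have "card (nonsink - {a}) = n - 2" using a by (simp add: card_nonsink card_verts sink_in_verts)
      ultimately have "card {y \<in> pairs. a = fst y} = n - 2" "card {y \<in> pairs. a = snd y} = n - 2"
        by (simp_all add: card_image inj_on_def)
      then show "(\<Sum>y\<in>pairs. of_bool (a = fst y)) = real (n - 2)"
        "(\<Sum>y\<in>pairs. of_bool (a = snd y)) = real (n - 2)"
        unfolding of_bool_def sum.inter_filter[OF finite_pairs, symmetric] by simp_all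
    qed
    have cnt2: "(\<Sum>y\<in>pairs. of_bool (y = z)) \<le> (1::real)" for z :: "'a \<times> 'a"
      by (simp add: of_bool_def sum.delta finite_pairs)
    have ob: "of_bool (fst x = fst y \<and> snd x = snd y) = (of_bool (y = x) :: real)"
      "of_bool (fst x = snd y \<and> snd x = fst y) = (of_bool (y = (snd x, fst x)) :: real)" for y
      by (auto simp: prod_eq_iff)
    have "fst x \<in> nonsink" "snd x \<in> nonsink" using x by (auto simp: pairs_def)
    then show "(\<Sum>y\<in>pairs. T\<^sup>2 + (of_bool (fst x = fst y) * T + of_bool (snd x = snd y) * T
        + of_bool (fst x = snd y) * T + of_bool (snd x = fst y) * T)
        + (of_bool (fst x = fst y \<and> snd x = snd y) + of_bool (fst x = snd y \<and> snd x = fst y)))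
      \<le> N * T\<^sup>2 + 4 * real (n - 2) * T + 2"
      unfolding ob sum.distrib sum_distrib_right[symmetric]
      using cnt2[of x] cnt2[of "(snd x, fst x)"] by (simp add: cnt1 card_pairs N_def)
  qed
  also have "\<dots> = N * (N * T\<^sup>2 + 4 * real (n - 2) * T + 2)" by (simp add: card_pairs N_def)
  also have "\<dots> = (N * lam ^ t)\<^sup>2 + 4 * N * real (n - 2) * lam ^ t + 2 * N"
    by (simp add: T_def power2_eq_square algebra_simps)
  finally show ?thesis .
qed

lemma stat_sum_recurrent: "(\<Sum>\<eta>\<in>recurrent. stat \<sigma> \<eta>) = 0"
proof -
  have "complex_of_real (\<Sum>\<eta>\<in>recurrent. stat \<sigma> \<eta>)
      = (\<Sum>\<eta>\<in>recurrent. \<Sum>x\<in>pairs. ratio \<sigma> (swap (fst x) (snd x)) \<eta>)"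
    by (simp add: stat_eq_sum_ratio case_prod_beta)
  also have "\<dots> = (\<Sum>x\<in>pairs. \<Sum>\<eta>\<in>recurrent. ratio \<sigma> (swap (fst x) (snd x)) \<eta>)"
    by (rule sum.swap)
  also have "\<dots> = 0"
  proof (rule sum.neutral, rule ballI)
    fix x assume x: "x \<in> pairs"
    have "swap (fst x) (snd x) (fst x) = 1" using x by (auto simp: pairs_def swap_def)
    then have "\<not> int n dvd swap (fst x) (snd x) (fst x)" using n_ge_3 by auto
    then have "(\<Sum>\<eta>\<in>recurrent. chi (swap (fst x) (snd x)) \<eta>) = 0"
      using x by (intro sum_chi_recurrent[of _ "fst x"] balanced_swap) (auto simp: pairs_def)
    then show "(\<Sum>\<eta>\<in>recurrent. ratio \<sigma> (swap (fst x) (snd x)) \<eta>) = 0"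
      by (simp add: ratio_def sum_distrib_right[symmetric])
  qed
  finally show ?thesis by (simp only: of_real_eq_0_iff)
qed

section \<open>Lower bound on the total variation distance\<close>

lemma sum_pmf_chain_dist: "\<sigma> \<in> recurrent \<Longrightarrow> (\<Sum>\<eta>\<in>recurrent. pmf (chain_dist \<sigma> t) \<eta>) = 1"
  using set_chain_dist finite_recurrent by (intro sum_pmf_eq_1) auto

lemma sum_pmf_uniform: "(\<Sum>\<eta>\<in>recurrent. pmf uniform_dist \<eta>) = 1"
  using recurrent_nonempty finite_recurrent
  by (intro sum_pmf_eq_1) (auto simp: uniform_dist_def)

text \<open>Both distributions have mass 1 on \<open>recurrent\<close>, so the discrepancies on
  \<open>A\<close> and on its complement are equal in size; together they offset the factor
  1/2.\<close>

lemma tv_dist_ge: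
  assumes "A \<subseteq> recurrent" "(\<Sum>\<eta>\<in>recurrent. pmf P \<eta>) = 1" "(\<Sum>\<eta>\<in>recurrent. pmf Q \<eta>) = 1"
  shows "(\<Sum>\<eta>\<in>A. pmf P \<eta>) - (\<Sum>\<eta>\<in>A. pmf Q \<eta>) \<le> tv_dist P Q"
proof -
  let ?B = "recurrent - A"
  have split: "sum f recurrent = sum f A + sum f ?B" for f :: "_ \<Rightarrow> real"
    using sum.subset_diff[OF assms(1) finite_recurrent, of f] by simp
  have "(\<Sum>\<eta>\<in>A. pmf P \<eta>) - (\<Sum>\<eta>\<in>A. pmf Q \<eta>) = (\<Sum>\<eta>\<in>?B. pmf Q \<eta>) - (\<Sum>\<eta>\<in>?B. pmf P \<eta>)"
    using assms(2,3) by (simp add: split)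
  moreover have "(\<Sum>\<eta>\<in>A. pmf P \<eta>) - (\<Sum>\<eta>\<in>A. pmf Q \<eta>) \<le> (\<Sum>\<eta>\<in>A. \<bar>pmf P \<eta> - pmf Q \<eta>\<bar>)"
    unfolding sum_subtractf[symmetric] by (intro sum_mono) auto
  moreover have "(\<Sum>\<eta>\<in>?B. pmf Q \<eta>) - (\<Sum>\<eta>\<in>?B. pmf P \<eta>) \<le> (\<Sum>\<eta>\<in>?B. \<bar>pmf P \<eta> - pmf Q \<eta>\<bar>)"
    unfolding sum_subtractf[symmetric] by (intro sum_mono) auto
  ultimately show ?thesis unfolding tv_dist_def split by simp
qed

lemma tv_lower_bound:
  fixes t :: nat
  assumes \<sigma>: "\<sigma> \<in> recurrent" and n: "4 \<le> n" and g: "gap n 1 \<le> 1"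
  defines "x \<equiv> real (n - 2) * lam ^ t"
  shows "1 - 18 / x - 8 / x\<^sup>2 \<le> tv_dist (chain_dist \<sigma> t) uniform_dist"
proof -
  let ?P = "chain_dist \<sigma> t"
  define p where "p = real (n - 1)"
  define N where "N = real ((n - 1) * (n - 2))"
  define T where "T = lam ^ t"
  define m where "m = N * T"
  \<comment> \<open>The cut is half the mean under the chain: Chebyshev bounds the chain's mass off
    \<open>A\<close>, Markov the uniform mass of \<open>A\<close>.\<close>
  define A where "A = {\<eta> \<in> recurrent. m / 2 < stat \<sigma> \<eta>}"
  have "0 < lam" using n g by (simp add: lam_def field_simps)
  then have T: "0 < T" by (simp add: T_def)
  have pos: "0 < N" "0 < p" "0 < m" using n T by (simp_all add: N_def p_def m_def)
  have px: "m = p * x" by (simp add: m_def N_def p_def x_def T_def)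
  have x: "0 < x" using px pos by (simp add: zero_less_mult_iff)
  have "(\<Sum>\<eta>\<in>recurrent - A. pmf ?P \<eta>) * (m / 2)\<^sup>2 \<le> (\<Sum>\<eta>\<in>recurrent - A. pmf ?P \<eta> * (stat \<sigma> \<eta> - m)\<^sup>2)"
    unfolding sum_distrib_right
  proof (intro sum_mono mult_left_mono)
    fix \<eta> assume "\<eta> \<in> recurrent - A"
    then have "m / 2 \<le> m - stat \<sigma> \<eta>" by (auto simp: A_def)
    then have "(m / 2)\<^sup>2 \<le> (m - stat \<sigma> \<eta>)\<^sup>2" using pos by (intro power_mono) auto
    then show "(m / 2)\<^sup>2 \<le> (stat \<sigma> \<eta> - m)\<^sup>2" by (simp add: power2_commute)
  qed auto
  also have "\<dots> \<le> (\<Sum>\<eta>\<in>recurrent. pmf ?P \<eta> * (stat \<sigma> \<eta> - m)\<^sup>2)"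
    by (intro sum_mono2 finite_recurrent) auto
  also have "\<dots> = (\<Sum>\<eta>\<in>recurrent. pmf ?P \<eta> * (stat \<sigma> \<eta>)\<^sup>2 - 2 * m * (pmf ?P \<eta> * stat \<sigma> \<eta>) + m\<^sup>2 * pmf ?P \<eta>)"
    by (intro sum.cong) (auto simp: power2_eq_square algebra_simps)
  also have "\<dots> = (\<Sum>\<eta>\<in>recurrent. pmf ?P \<eta> * (stat \<sigma> \<eta>)\<^sup>2) - 2 * m * m + m\<^sup>2 * 1"
    using stat_mean[OF \<sigma>, of t] sum_pmf_chain_dist[OF \<sigma>, of t]
    by (simp add: sum.distrib sum_subtractf sum_distrib_left[symmetric] m_def N_def T_def)
  also have "\<dots> \<le> 4 * N * real (n - 2) * T + 2 * N"
  proof -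
    have "(\<Sum>\<eta>\<in>recurrent. pmf ?P \<eta> * (stat \<sigma> \<eta>)\<^sup>2) \<le> m\<^sup>2 + 4 * N * real (n - 2) * T + 2 * N"
      unfolding m_def N_def T_def by (rule stat_second_moment[OF \<sigma> n g])
    then show ?thesis by (simp add: power2_eq_square)
  qed
  also have "4 * N * real (n - 2) * T + 2 * N = N * (4 * x + 2)"
    by (simp add: x_def T_def algebra_simps)
  finally have "(\<Sum>\<eta>\<in>recurrent - A. pmf ?P \<eta>) * (m / 2)\<^sup>2 \<le> N * (4 * x + 2)" .
  \<comment> \<open>With m = px and N = p(n - 2), dividing the variance bound by (m/2)^2 leaves
    (16/x + 8/x^2)(n - 2)/p, and (n - 2)/p is at most 1.\<close>
  moreover have "N * (4 * x + 2) = (16 / x + 8 / x\<^sup>2) * (real (n - 2) / p) * (m / 2)\<^sup>2"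
  proof -
    define q where "q = real (n - 2)"
    have "N = p * q" by (simp add: N_def p_def q_def)
    then show ?thesis unfolding px q_def[symmetric] using x pos by (simp add: field_simps power2_eq_square)
  qed
  ultimately have "(\<Sum>\<eta>\<in>recurrent - A. pmf ?P \<eta>) * (m / 2)\<^sup>2
      \<le> (16 / x + 8 / x\<^sup>2) * (real (n - 2) / p) * (m / 2)\<^sup>2" by (simp only:)
  then have "(\<Sum>\<eta>\<in>recurrent - A. pmf ?P \<eta>) \<le> (16 / x + 8 / x\<^sup>2) * (real (n - 2) / p)"
    by (rule mult_right_le_imp_le) (use pos in simp)
  also have "\<dots> \<le> (16 / x + 8 / x\<^sup>2) * 1"
    using x pos by (intro mult_left_mono) (auto simp: p_def)
  finally have PA: "(\<Sum>\<eta>\<in>recurrent - A. pmf ?P \<eta>) \<le> 16 / x + 8 / x\<^sup>2" by simp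
  have A: "A \<subseteq> recurrent" by (auto simp: A_def)
  \<comment> \<open>Markov is applied to \<open>stat \<sigma> \<eta> + p\<close>, a squared modulus
    with uniform mean p; since m = px this gives 2/x.\<close>
  have "(\<Sum>\<eta>\<in>A. pmf uniform_dist \<eta>) * (m / 2) \<le> (\<Sum>\<eta>\<in>A. pmf uniform_dist \<eta> * (stat \<sigma> \<eta> + p))"
    unfolding sum_distrib_right using pos by (intro sum_mono mult_left_mono) (auto simp: A_def)
  also have "\<dots> \<le> (\<Sum>\<eta>\<in>recurrent. pmf uniform_dist \<eta> * (stat \<sigma> \<eta> + p))"
    by (intro sum_mono2 finite_recurrent A mult_nonneg_nonneg) (auto simp: stat_def p_def)
  also have "\<dots> = (\<Sum>\<eta>\<in>recurrent. stat \<sigma> \<eta>) / real (card recurrent) + p * (\<Sum>\<eta>\<in>recurrent. pmf uniform_dist \<eta>)"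
    unfolding sum_divide_distrib sum_distrib_left sum.distrib[symmetric]
    by (intro sum.cong refl) (simp add: pmf_uniform field_simps add_divide_distrib)
  also have "\<dots> = p" by (simp add: stat_sum_recurrent sum_pmf_uniform)
  finally have "(\<Sum>\<eta>\<in>A. pmf uniform_dist \<eta>) \<le> 2 / x"
    using x pos unfolding px by (simp add: field_simps)
  moreover have "(\<Sum>\<eta>\<in>A. pmf ?P \<eta>) = 1 - (\<Sum>\<eta>\<in>recurrent - A. pmf ?P \<eta>)"
    using sum.subset_diff[OF A finite_recurrent, of "pmf ?P"] sum_pmf_chain_dist[OF \<sigma>, of t] by simp
  ultimately show ?thesis
    using tv_dist_ge[OF A sum_pmf_chain_dist[OF \<sigma>, of t] sum_pmf_uniform] PA by (simp add: add_divide_distrib[symmetric])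
qed

end

text \<open>At the last admissible time \<open>lam ^ t\<close> is about exp(4 pi^2 c)/n, so
  \<open>x\<close> is at least about exp(4 pi^2 c). Since 4 pi^2 exceeds 39, a rate of 35 leaves
  room for all constants.\<close>

lemma lower_estimate:
  fixes n t :: nat and c :: real
  assumes n: "3 \<le> n" and c: "5 / 4 \<le> c"
    and t: "real t \<le> 1 / (4 * pi\<^sup>2) * real n ^ 3 * ln (real n) - c * real n ^ 3"
  defines "x \<equiv> real (n - 2) * (1 - 2 * gap n 1 / real n) ^ t"
  shows "49 \<le> n" "gap n 1 \<le> 1" "18 / x + 8 / x\<^sup>2 \<le> exp (- 35 * c)"
proof -
  \<comment> \<open>\<open>Y\<close> bounds the loss per step coming from \<open>gap_1_le\<close>,
    and \<open>M\<close> is \<open>Y\<close> times the largest admissible time.\<close>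
  define M where "M = ln (real n) - 4 * pi\<^sup>2 * c"
  define Y where "Y = 4 * pi\<^sup>2 / real n ^ 3"
  have n0: "real n > 0" using n by simp
  have "real t * Y \<le> (1 / (4 * pi\<^sup>2) * real n ^ 3 * ln (real n) - c * real n ^ 3) * Y"
    using t by (intro mult_right_mono) (auto simp: Y_def)
  also have "\<dots> = M" using n0 by (simp add: M_def Y_def field_simps)
  finally have tY: "real t * Y \<le> M" .
  have "0 \<le> real t * Y" by (simp add: Y_def)
  then have M0: "0 \<le> M" using tY by linarith
  have pc: "(196 / 5) * c \<le> 4 * pi\<^sup>2 * c" using pi_squared_bounds c by (intro mult_right_mono) auto
  \<comment> \<open>The existence of an admissible \<open>t\<close> forces \<open>M\<close> to be
    nonnegative, and 49 = (196/5) * (5/4).\<close>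
  then have "49 \<le> ln (real n)" using M0 c unfolding M_def by linarith
  then have n49: "49 \<le> real n" using ln_le_minus_one[OF n0] by linarith
  then show "49 \<le> n" by simp
  have sq: "2401 \<le> (real n)\<^sup>2" using power_mono[of 49 "real n" 2] n49 by simp
  have "2 * pi\<^sup>2 / (real n)\<^sup>2 \<le> (2 * (79 / 8)) / 2401" using pi_squared_bounds sq by (intro frac_le) auto
  then show g: "gap n 1 \<le> 1" using gap_1_le[of n] by simp
  define y where "y = 2 * gap n 1 / real n"
  have y0: "0 \<le> y" by (simp add: y_def)
  have "y \<le> 2 * (2 * pi\<^sup>2 / (real n)\<^sup>2) / real n"
    unfolding y_def using gap_1_le[of n] n0 by (intro divide_right_mono mult_left_mono) auto
  then have yY: "y \<le> Y" by (simp add: Y_def power2_eq_square power3_eq_cube mult.commute)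
  have YL: "Y * ln (real n) \<le> 1 / 50"
  proof -
    have "Y * ln (real n) \<le> Y * real n"
      using ln_le_minus_one[OF n0] by (intro mult_left_mono) (auto simp: Y_def)
    also have "\<dots> = 4 * pi\<^sup>2 / (real n)\<^sup>2" using n0 by (simp add: Y_def power2_eq_square power3_eq_cube)
    also have "\<dots> \<le> (4 * (79 / 8)) / 2401" using pi_squared_bounds sq by (intro frac_le) auto
    finally show ?thesis by simp
  qed
  have "0 \<le> Y" by (simp add: Y_def)
  then have "Y * 49 \<le> 1 / 50" using mult_left_mono[OF \<open>49 \<le> ln (real n)\<close>, of Y] YL by linarith
  then have Y2: "Y \<le> 1 / 2" by simp
  \<comment> \<open>The quadratic term costs at most 2tY^2 <= 2MY <= 2Y ln n <= 1/25 over the whole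
    run.\<close>
  have "- Y - 2 * Y\<^sup>2 \<le> ln (1 - Y)" using \<open>0 \<le> Y\<close> Y2 by (intro ln_one_minus_pos_lower_bound)
  also have "\<dots> \<le> ln (1 - y)" using yY Y2 by simp
  finally have "real t * (- Y - 2 * Y\<^sup>2) \<le> real t * ln (1 - y)" by (rule mult_left_mono) simp
  moreover have "real t * Y * (1 + 2 * Y) \<le> M * (1 + 2 * Y)" using tY \<open>0 \<le> Y\<close> by (intro mult_right_mono) auto
  moreover have "M * Y \<le> ln (real n) * Y"
    using c \<open>0 \<le> Y\<close> by (intro mult_right_mono) (auto simp: M_def)
  ultimately have "- M - 1 / 25 \<le> real t * ln (1 - y)"
    using YL by (simp add: algebra_simps power2_eq_square)
  then have "exp (- M - 1 / 25) \<le> exp (real t * ln (1 - y))" by simp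
  also have "\<dots> = (1 - y) ^ t" using yY Y2 by (simp add: exp_of_nat_mult)
  finally have "real (n - 2) * exp (- M - 1 / 25) \<le> x" unfolding x_def y_def by (rule mult_left_mono) simp
  moreover have "exp (- M - 1 / 25) = exp (4 * pi\<^sup>2 * c) / real n * exp (- (1 / 25))"
  proof -
    have "- M - 1 / 25 = 4 * pi\<^sup>2 * c + - ln (real n) + - (1 / 25)" by (simp add: M_def)
    moreover have "exp (- ln (real n)) = 1 / real n" using n0 by (simp add: exp_minus field_simps)
    ultimately show ?thesis by (simp only: exp_add) simp
  qed
  moreover have "9 / 10 * exp (196 / 5 * c) \<le> (real (n - 2) / real n * exp (- (1 / 25))) * exp (4 * pi\<^sup>2 * c)"
  proof (rule mult_mono)
    have "47 / 49 \<le> real (n - 2) / real n" using n49 by (simp add: field_simps of_nat_diff)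
    moreover have "24 / 25 \<le> exp (- (1 / 25) :: real)" using exp_ge_add_one_self[of "- (1 / 25) :: real"] by simp
    ultimately have "47 / 49 * (24 / 25) \<le> real (n - 2) / real n * exp (- (1 / 25))"
      by (intro mult_mono) (assumption | simp)+
    then show "9 / 10 \<le> real (n - 2) / real n * exp (- (1 / 25))" by (rule order_trans[rotated]) simp
  qed (use pc in auto)
  ultimately have xge: "9 / 10 * exp (196 / 5 * c) \<le> x" by (simp add: mult.commute mult.left_commute)
  \<comment> \<open>21/5 = 196/5 - 35 is the surplus rate; at c = 5/4 it already gives exp(21/4) >=
    36, and 9/10 * 36 > 32.\<close>
  have "36 \<le> exp (21 / 5 * c)"
  proof -
    have "(2 + 1 / 20) ^ 5 \<le> exp (21 / 20 :: real) ^ 5"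
      using exp_ge_add_one_self[of "21 / 20 :: real"] by (intro power_mono) auto
    also have "\<dots> = exp (21 / 4)" by (simp add: exp_of_nat_mult[symmetric])
    also have "\<dots> \<le> exp (21 / 5 * c)" using c by simp
    finally show ?thesis by (simp add: power_divide)
  qed
  then have "36 * exp (35 * c) \<le> exp (21 / 5 * c) * exp (35 * c)" by (rule mult_right_mono) simp
  also have "\<dots> = exp (196 / 5 * c)" by (simp add: exp_add[symmetric])
  finally have x32: "32 * exp (35 * c) \<le> x" using xge exp_gt_zero[of "35 * c"] by linarith
  have "1 \<le> exp (35 * c)" using c by simp
  then have x8: "8 \<le> x" using x32 by linarith
  have "8 / x\<^sup>2 = (8 / x) / x" by (simp add: power2_eq_square)
  also have "\<dots> \<le> 1 / x" using x8 by (intro divide_right_mono) auto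
  finally have "18 / x + 8 / x\<^sup>2 \<le> 19 / x" by simp
  also have "\<dots> \<le> 32 / (32 * exp (35 * c))" using x32 x8 by (intro frac_le) auto
  also have "\<dots> = exp (- 35 * c)" by (simp add: exp_minus field_simps)
  finally show "18 / x + 8 / x\<^sup>2 \<le> exp (- 35 * c)" .
qed

section \<open>Cutoff\<close>

theorem theorem1p3:
  fixes G :: "('a, 'b) pre_digraph" and s :: 'a and n :: nat
    and \<sigma> :: "'a \<Rightarrow> nat" and c :: real
  assumes "n \<ge> 3"
    and "complete_digraph n G"
    and "s \<in> verts G"
    and "\<sigma> \<in> sandpile.recurrent G s"
    and "c \<ge> 5 / 4"
  shows "(\<forall>t :: nat. real t \<ge> 1 / (4 * pi\<^sup>2) * real n ^ 3 * ln (real n) + c * real n ^ 3 \<longrightarrow>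
            sandpile.tv_dist G s (sandpile.chain_dist G s \<sigma> t) (sandpile.uniform_dist G s)
              \<le> exp (- c))
       \<and> (\<forall>t :: nat. real t \<le> 1 / (4 * pi\<^sup>2) * real n ^ 3 * ln (real n) - c * real n ^ 3 \<longrightarrow>
            sandpile.tv_dist G s (sandpile.chain_dist G s \<sigma> t) (sandpile.uniform_dist G s)
              \<ge> 1 - exp (- 35 * c))"
proof (intro conjI allI impI)
  interpret sandpile G s using assms(2,3) by (rule complete_digraph_sandpile)
  interpret complete_sandpile G s n using assms(1,2) by unfold_locales
  fix t :: nat
  show "tv_dist (chain_dist \<sigma> t) uniform_dist \<le> exp (- c)"
    if t: "real t \<ge> 1 / (4 * pi\<^sup>2) * real n ^ 3 * ln (real n) + c * real n ^ 3"
  \<comment> \<open>Squares are compared, because the Fourier bound controls four times the squared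
    distance; that 4 cancels against the 4 of \<open>upper_estimate\<close>.\<close>
  proof (rule power2_le_imp_le)
    let ?D = "duals - {trivial_dual}"
    have D: "?D \<subseteq> verts G \<rightarrow>\<^sub>E {0..<int n}" "\<And>j. j \<in> ?D \<Longrightarrow> j s = 0" "(\<lambda>v\<in>verts G. 0) \<notin> ?D"
      by (auto simp: duals_def balanced_def trivial_dual_def)
    have "4 * (tv_dist (chain_dist \<sigma> t) uniform_dist)\<^sup>2 \<le> (\<Sum>j\<in>?D. ((cmod (eigenvalue j))\<^sup>2) ^ t)"
      by (rule tv_upper_bound[OF assms(4)])
    also have "\<dots> = (\<Sum>j\<in>?D. ((cmod (\<Sum>v\<in>verts G. zeta n (j v)) / real n)\<^sup>2) ^ t)"
      by (simp add: eigenvalue_def norm_divide)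
    also have "\<dots> \<le> 4 * exp (- (2 * c))"
      by (rule order_trans[OF sum_by_mode[where V = "verts G" and n = n and s = s and D = ?D and t = t,
              OF finite_verts card_verts n_pos sink_in_verts D(1) _ D(3)]
            upper_estimate[OF assms(1,5) t]])
        (rule D(2))
    finally show "(tv_dist (chain_dist \<sigma> t) uniform_dist)\<^sup>2 \<le> (exp (- c))\<^sup>2"
      by (simp add: exp_double[symmetric])
  qed simp
  show "1 - exp (- 35 * c) \<le> tv_dist (chain_dist \<sigma> t) uniform_dist"
    if t: "real t \<le> 1 / (4 * pi\<^sup>2) * real n ^ 3 * ln (real n) - c * real n ^ 3"
  proof -
    note est = lower_estimate[OF assms(1,5) t]
    define x where "x = real (n - 2) * lam ^ t"
    have "1 - 18 / x - 8 / x\<^sup>2 \<le> tv_dist (chain_dist \<sigma> t) uniform_dist"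
      unfolding x_def using est(1,2) by (intro tv_lower_bound[OF assms(4)]) auto
    moreover have "18 / x + 8 / x\<^sup>2 \<le> exp (- 35 * c)"
      using est(3) by (simp only: x_def lam_def)
    ultimately show ?thesis by linarith
  qed
qed

end
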